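(* For $a,b\in\mathbb N$ and $m\in\mathbb Z$, in the modified quantum group $\dot{\mathbf U}$ of $\mathfrak{sl}_2$ we have $$\mathfrak w_m(a,b)=\begin{cases}\displaystyle\sum_{s=0}^{\min(a,b)}(-1)^s\frac{q^{-s+s(a-b+m)}}{(q^{-2};q^{-2})_s}E^{(a-s)}F^{(b-s)}\mathbf 1_m,&\text{if }m\le b-a,\\[2ex]\displaystyle\sum_{s=0}^{\min(a,b)}(-1)^s\frac{q^{-s-s(a-b+m)}}{(q^{-2};q^{-2})_s}F^{(b-s)}E^{(a-s)}\mathbf 1_m,&\text{if }m\ge b-a.\end{cases}$$
   Context: $\mathbf U=\mathbf U_q(\mathfrak{sl}_2)$ is the $\mathbb Q(q)$-algebra generated by $E,F,K^{\pm1}$ with $KE=q^2EK$, $KF=q^{-2}FK$, $EF-FE=(K-K^{-1})/(q-q^{-1})$ and comultiplication $\Delta(K)=K\otimes K$, $\Delta(E)=E\otimes1+K\otimes E$, $\Delta(F)=F\otimes K^{-1}+1\otimes F$. $\mathbf U^+,\mathbf U^-$ are the subalgebras generated by $E$, resp. $F$. $E^{(a)}=E^a/[a]!$, $F^{(a)}=F^a/[a]!$ with $[a]!=\prod_{k=1}^a\frac{q^k-q^{-k}}{q-q^{-1}}$. The weight lattice is $X=\mathbb Z$, $X^+=\mathbb N=\{0,1,2,\dots\}$. $\dot{\mathbf U}$ is Lusztig's modified quantum group, with orthogonal idempotents $\mathbf 1_m$ ($m\in\mathbb Z$), $K\mathbf 1_m=q^m\mathbf 1_m$, $E\mathbf 1_m=\mathbf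 1_{m+2}E$, $F\mathbf 1_m=\mathbf 1_{m-2}F$; it acts on weight modules, $\mathbf 1_m$ acting as projection to the weight space where $K=q^m$. For $n\in\mathbb N$, $L(n)$ is the $(n+1)$-dimensional simple module with highest weight vector $\eta_n$ of weight $n$, and ${}^\omega L(n)$ the simple module with lowest weight vector $\xi_{-n}$ of weight $-n$. $(q^{-2};q^{-2})_s=\prod_{k=1}^s(1-q^{-2k})$. For fixed $m\in\mathbb Z$, a sequence $z_p\in{}^\omega L(p)\otimes L(p+m)$ (indexed by $p\in\mathbb N$ with $p+m\in\mathbb N$) is written $o(1)$ (asymptotically zero) if it can be written as a linear combination of elements $u\mathbf 1_m(\xi_{-p}\otimes\eta_{p+m})$ ($u\in\dot{\mathbf U}$) and $x\xi_{-p}\otimes y\eta_{p+m}$ ($(x,y)\in\mathbf U^+\times\mathbf U^-$), with $u$ and $(x,y)$ running over finite sets independent of $p$, with coefficients finite sums $\sum_{s\ge1}f_s(q)q^{-2sp}$, $f_s(q)\in\mathbb Q(q)$ independent of $p$. For $a,b\in\mathbb N$, $m\in\mathbb Z$, $\mathfrak w_m(a,b)$ is the unique element of $\dot{\mathbf U}\mathbf 1_m$ such that $\mathfrak w_m(a,b)(\xi_{-p}\otimes\eta_{p+m})-E^{(a)}\xi_{-p}\otimes F^{(b)}\eta_{p+m}=o(1)$ (existence and uniqueness are established beforehand in the paper). *)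

theory Defs
  imports Complex_Main "HOL-Computational_Algebra.Polynomial" "HOL-Computational_Algebra.Fraction_Field"
begin

section \<open>The field \<open>\<rat>(q)\<close> and quantum integers\<close>

type_synonym qf = "rat poly fract"

definition q :: qf where
  "q = Fract [:0, 1:] 1"

definition qint :: "int \<Rightarrow> qf" where
  "qint n = (q powi n - q powi (- n)) / (q - q powi (- 1))"

definition qfact :: "nat \<Rightarrow> qf" where
  "qfact n = (\<Prod>k=1..n. qint (int k))"

text \<open>\<open>(q\<^sup>-\<^sup>2; q\<^sup>-\<^sup>2)\<^sub>s\<close>\<close>

definition qpoch :: "nat \<Rightarrow> qf" where
  "qpoch s = (\<Prod>k=1..s. (1 - q powi (- 2 * int k)))"

lemma q_nz [simp]: "q \<noteq> 0"
  by (simp add: q_def Zero_fract_def eq_fract)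


section \<open>The quantum group and its modified form\<close>

text \<open>
  We present the unital \<open>\<rat>(q)\<close>-algebra \<open>\<^bold>U\<^sup>^\<close> generated by \<open>E, F, K, K\<^sup>-\<^sup>1\<close> and by orthogonal
  idempotents \<open>1\<^sub>m\<close> (\<open>m \<in> \<int>\<close>), subject to the relations of \<open>\<^bold>U\<close> and
  \<open>K 1\<^sub>m = q\<^sup>m 1\<^sub>m = 1\<^sub>m K\<close>, \<open>E 1\<^sub>m = 1\<^sub>m\<^sub>+\<^sub>2 E\<close>, \<open>F 1\<^sub>m = 1\<^sub>m\<^sub>-\<^sub>2 F\<close>.
  Lusztig's modified quantum group \<open>\<^bold>U\<^sup>.\<close> is a \<open>\<^bold>U\<close>-bimodule and a non-unital algebra, and the algebra
  above is the semidirect sum \<open>\<^bold>U \<oplus> \<^bold>U\<^sup>.\<close>: the subalgebra generated by \<open>E, F, K, K\<^sup>-\<^sup>1\<close> is \<open>\<^bold>U\<close>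
  (it is split off by the homomorphism killing all \<open>1\<^sub>m\<close>), and the two-sided ideal generated by the
  \<open>1\<^sub>m\<close> is \<open>\<^bold>U\<^sup>.\<close>.
  Thus \<open>\<^bold>U\<close> and \<open>\<^bold>U\<^sup>.\<close> live in one ring, and expressions such as \<open>E\<^sup>a F\<^sup>b 1\<^sub>m\<close> are products in it.
  The presentation is the algebra of formal expressions modulo the smallest congruence
  containing the axioms of unital associative algebras and these relations.
\<close>

datatype uterm =
    Scal qf
  | GenE | GenF | GenK | GenKi
  | Idem int
  | Add uterm uterm
  | Mul uterm uterm

inductive ueq :: "uterm \<Rightarrow> uterm \<Rightarrow> bool" where
  ueq_refl: "ueq x x"
| ueq_sym: "ueq x y \<Longrightarrow> ueq y x"
| ueq_trans: "ueq x y \<Longrightarrow> ueq y z \<Longrightarrow> ueq x z"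
| Add_cong: "ueq x x' \<Longrightarrow> ueq y y' \<Longrightarrow> ueq (Add x y) (Add x' y')"
| Mul_cong: "ueq x x' \<Longrightarrow> ueq y y' \<Longrightarrow> ueq (Mul x y) (Mul x' y')"
\<comment> \<open>associative unital algebra over \<open>\<rat>(q)\<close>\<close>
| Add_assoc: "ueq (Add (Add x y) z) (Add x (Add y z))"
| Add_comm: "ueq (Add x y) (Add y x)"
| Add_zero: "ueq (Add (Scal 0) x) x"
| Add_neg: "ueq (Add (Mul (Scal (- 1)) x) x) (Scal 0)"
| Mul_assoc: "ueq (Mul (Mul x y) z) (Mul x (Mul y z))"
| Mul_one_left: "ueq (Mul (Scal 1) x) x"
| Mul_one_right: "ueq (Mul x (Scal 1)) x"
| Mul_Add_left: "ueq (Mul (Add x y) z) (Add (Mul x z) (Mul y z))"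
| Mul_Add_right: "ueq (Mul x (Add y z)) (Add (Mul x y) (Mul x z))"
| Scal_Add: "ueq (Scal (c + d)) (Add (Scal c) (Scal d))"
| Scal_Mul: "ueq (Scal (c * d)) (Mul (Scal c) (Scal d))"
| Scal_central: "ueq (Mul (Scal c) x) (Mul x (Scal c))"
\<comment> \<open>relations of \<open>\<^bold>U\<close>\<close>
| K_Ki: "ueq (Mul GenK GenKi) (Scal 1)"
| Ki_K: "ueq (Mul GenKi GenK) (Scal 1)"
| K_E: "ueq (Mul GenK GenE) (Mul (Scal (q powi 2)) (Mul GenE GenK))"
| K_F: "ueq (Mul GenK GenF) (Mul (Scal (q powi (- 2))) (Mul GenF GenK))"
| E_F: "ueq (Add (Mul GenE GenF) (Mul (Scal (- 1)) (Mul GenF GenE)))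
            (Mul (Scal (1 / (q - q powi (- 1)))) (Add GenK (Mul (Scal (- 1)) GenKi)))"
\<comment> \<open>relations involving the idempotents\<close>
| Idem_same: "ueq (Mul (Idem m) (Idem m)) (Idem m)"
| Idem_orth: "m \<noteq> n \<Longrightarrow> ueq (Mul (Idem m) (Idem n)) (Scal 0)"
| K_Idem: "ueq (Mul GenK (Idem m)) (Mul (Scal (q powi m)) (Idem m))"
| Idem_K: "ueq (Mul (Idem m) GenK) (Mul (Scal (q powi m)) (Idem m))"
| E_Idem: "ueq (Mul GenE (Idem m)) (Mul (Idem (m + 2)) GenE)"
| F_Idem: "ueq (Mul GenF (Idem m)) (Mul (Idem (m - 2)) GenF)"

quotient_type uhat = uterm / ueq
  by (intro equivpI reflpI sympI transpI) (blast intro: ueq.intros)+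

lift_definition scal :: "qf \<Rightarrow> uhat" is Scal .
lift_definition gE :: uhat is GenE .
lift_definition gF :: uhat is GenF .
lift_definition gK :: uhat is GenK .
lift_definition gKi :: uhat is GenKi .
lift_definition idem :: "int \<Rightarrow> uhat" is Idem .

text \<open>The counit (with \<open>1\<^sub>m \<mapsto> \<delta>\<^sub>m\<^sub>,\<^sub>0\<close>) is only used to show that the algebra is not the zero ring.\<close>

primrec counit_term :: "uterm \<Rightarrow> qf" where
  "counit_term (Scal c) = c"
| "counit_term GenE = 0"
| "counit_term GenF = 0"
| "counit_term GenK = 1"
| "counit_term GenKi = 1"
| "counit_term (Idem m) = (if m = 0 then 1 else 0)"
| "counit_term (Add x y) = counit_term x + counit_term y"
| "counit_term (Mul x y) = counit_term x * counit_term y"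

lemma counit_term_ueq: "ueq x y \<Longrightarrow> counit_term x = counit_term y"
  by (induction rule: ueq.induct) (auto simp: algebra_simps)

instantiation uhat :: ring_1
begin

lift_definition zero_uhat :: uhat is "Scal 0" .
lift_definition one_uhat :: uhat is "Scal 1" .
lift_definition plus_uhat :: "uhat \<Rightarrow> uhat \<Rightarrow> uhat" is Add by (rule Add_cong)
lift_definition times_uhat :: "uhat \<Rightarrow> uhat \<Rightarrow> uhat" is Mul by (rule Mul_cong)
lift_definition uminus_uhat :: "uhat \<Rightarrow> uhat" is "Mul (Scal (- 1))"
  by (rule Mul_cong[OF ueq_refl])
definition minus_uhat :: "uhat \<Rightarrow> uhat \<Rightarrow> uhat" where "minus_uhat x y = x + - y"

instance
proof
  fix a b c :: uhat
  show "a + b + c = a + (b + c)" by transfer (rule Add_assoc)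
  show "a + b = b + a" by transfer (rule Add_comm)
  show "0 + a = a" by transfer (rule Add_zero)
  show "- a + a = 0" by transfer (rule Add_neg)
  show "a - b = a + - b" by (rule minus_uhat_def)
  show "a * b * c = a * (b * c)" by transfer (rule Mul_assoc)
  show "1 * a = a" by transfer (rule Mul_one_left)
  show "a * 1 = a" by transfer (rule Mul_one_right)
  show "(a + b) * c = a * c + b * c" by transfer (rule Mul_Add_left)
  show "a * (b + c) = a * b + a * c" by transfer (rule Mul_Add_right)
  show "(0::uhat) \<noteq> 1" by transfer (auto dest: counit_term_ueq)
qed

end

lemma scal_0 [simp]: "scal 0 = 0" by transfer (rule ueq_refl)
lemma scal_1 [simp]: "scal 1 = 1" by transfer (rule ueq_refl)
lemma scal_add: "scal (c + d) = scal c + scal d" by transfer (rule Scal_Add)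
lemma scal_mult: "scal (c * d) = scal c * scal d" by transfer (rule Scal_Mul)
lemma scal_central: "scal c * x = x * scal c" by transfer (rule Scal_central)
lemma scal_uminus: "scal (- c) = - scal c"
  by (metis add.right_inverse add_eq_0_iff scal_0 scal_add)

lemma gK_gKi: "gK * gKi = 1" by transfer (rule K_Ki)
lemma gKi_gK: "gKi * gK = 1" by transfer (rule Ki_K)
lemma gK_gE: "gK * gE = scal (q powi 2) * (gE * gK)" by transfer (rule K_E)
lemma gK_gF: "gK * gF = scal (q powi (- 2)) * (gF * gK)" by transfer (rule K_F)
lemma gE_gF: "gE * gF - gF * gE = scal (1 / (q - q powi (- 1))) * (gK - gKi)"
  unfolding minus_uhat_def by transfer (rule E_F)
lemma idem_idem: "idem m * idem n = (if m = n then idem m else 0)"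
proof (cases "m = n")
  case True
  have "idem n * idem n = idem n" by transfer (rule Idem_same)
  with True show ?thesis by simp
next
  case False
  then have "idem m * idem n = 0" by transfer (rule Idem_orth)
  with False show ?thesis by simp
qed
lemma gK_idem: "gK * idem m = scal (q powi m) * idem m" by transfer (rule K_Idem)
lemma idem_gK: "idem m * gK = scal (q powi m) * idem m" by transfer (rule Idem_K)
lemma gE_idem: "gE * idem m = idem (m + 2) * gE" by transfer (rule E_Idem)
lemma gF_idem: "gF * idem m = idem (m - 2) * gF" by transfer (rule F_Idem)

definition Ediv :: "nat \<Rightarrow> uhat" where
  "Ediv a = scal (1 / qfact a) * gE ^ a"

definition Fdiv :: "nat \<Rightarrow> uhat" where
  "Fdiv a = scal (1 / qfact a) * gF ^ a"

inductive_set subalg :: "uhat set \<Rightarrow> uhat set" for X where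
  subalg_gen: "x \<in> X \<Longrightarrow> x \<in> subalg X"
| subalg_scal: "scal c \<in> subalg X"
| subalg_add: "x \<in> subalg X \<Longrightarrow> y \<in> subalg X \<Longrightarrow> x + y \<in> subalg X"
| subalg_mult: "x \<in> subalg X \<Longrightarrow> y \<in> subalg X \<Longrightarrow> x * y \<in> subalg X"

definition Uplus :: "uhat set" where "Uplus = subalg {gE}"

definition Uminus :: "uhat set" where "Uminus = subalg {gF}"

text \<open>\<open>\<^bold>U\<^sup>.\<close>, the two-sided ideal generated by the idempotents \<open>1\<^sub>m\<close>:\<close>

inductive_set Udot :: "uhat set" where
  Udot_zero: "0 \<in> Udot"
| Udot_gen: "x * idem m * y \<in> Udot"
| Udot_add: "x \<in> Udot \<Longrightarrow> y \<in> Udot \<Longrightarrow> x + y \<in> Udot"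

definition Udot_idem :: "int \<Rightarrow> uhat set" where
  "Udot_idem m = {u * idem m | u. u \<in> Udot}"


section \<open>Weight modules\<close>

text \<open>
  A finite-dimensional weight module is given in a basis of weight vectors: \<open>wt i\<close> is the weight
  of the basis vector \<open>i\<close> (on which \<open>K\<close> acts by \<open>q\<^sup>w\<^sup>t\<^sup>(\<^sup>i\<^sup>)\<close>), and \<open>Emat i j\<close>, \<open>Fmat i j\<close> are the coefficients
  of the basis vector \<open>i\<close> in \<open>E j\<close>, \<open>F j\<close>.  Vectors are coordinate functions that vanish outside
  the basis.
\<close>

record 'i wmod =
  basis :: "'i set"
  wt :: "'i \<Rightarrow> int"
  Emat :: "'i \<Rightarrow> 'i \<Rightarrow> qf"
  Fmat :: "'i \<Rightarrow> 'i \<Rightarrow> qf"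

definition vecs :: "'i wmod \<Rightarrow> ('i \<Rightarrow> qf) set" where
  "vecs M = {v. \<forall>i. i \<notin> basis M \<longrightarrow> v i = 0}"

definition mat_vec :: "'i set \<Rightarrow> ('i \<Rightarrow> 'i \<Rightarrow> qf) \<Rightarrow> ('i \<Rightarrow> qf) \<Rightarrow> 'i \<Rightarrow> qf" where
  "mat_vec B A v = (\<lambda>i. if i \<in> B then \<Sum>j\<in>B. A i j * v j else 0)"

text \<open>The idempotent \<open>1\<^sub>m\<close> acts as the projection to the weight space of weight \<open>m\<close>.\<close>

primrec act_term :: "'i wmod \<Rightarrow> uterm \<Rightarrow> ('i \<Rightarrow> qf) \<Rightarrow> 'i \<Rightarrow> qf" where
  "act_term M (Scal c) v = (\<lambda>i. c * v i)"
| "act_term M GenE v = mat_vec (basis M) (Emat M) v"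
| "act_term M GenF v = mat_vec (basis M) (Fmat M) v"
| "act_term M GenK v = (\<lambda>i. q powi (wt M i) * v i)"
| "act_term M GenKi v = (\<lambda>i. q powi (- wt M i) * v i)"
| "act_term M (Idem m) v = (\<lambda>i. if wt M i = m then v i else 0)"
| "act_term M (Add x y) v = (\<lambda>i. act_term M x v i + act_term M y v i)"
| "act_term M (Mul x y) v = act_term M x (act_term M y v)"

text \<open>The action is independent of the chosen representative whenever \<open>M\<close> satisfies the
  relations; see \<open>act_term_ueq\<close> and \<open>weight_module\<close> below.\<close>

definition act :: "'i wmod \<Rightarrow> uhat \<Rightarrow> ('i \<Rightarrow> qf) \<Rightarrow> 'i \<Rightarrow> qf" where
  "act M u v = act_term M (rep_uhat u) v"

definition weight_module :: "'i wmod \<Rightarrow> bool" where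
  "weight_module M \<longleftrightarrow> finite (basis M)
     \<and> (\<forall>i\<in>basis M. \<forall>j\<in>basis M. Emat M i j \<noteq> 0 \<longrightarrow> wt M i = wt M j + 2)
     \<and> (\<forall>i\<in>basis M. \<forall>j\<in>basis M. Fmat M i j \<noteq> 0 \<longrightarrow> wt M i = wt M j - 2)
     \<and> (\<forall>i\<in>basis M. \<forall>j\<in>basis M.
          (\<Sum>k\<in>basis M. Emat M i k * Fmat M k j) - (\<Sum>k\<in>basis M. Fmat M i k * Emat M k j)
            = (if i = j then qint (wt M i) else 0))"

lemma act_term_vecs: "v \<in> vecs M \<Longrightarrow> act_term M x v \<in> vecs M"
  by (induction x arbitrary: v) (auto simp: vecs_def mat_vec_def)

lemma act_term_linear:
  "act_term M x (\<lambda>i. c * v i + w i) = (\<lambda>i. c * act_term M x v i + act_term M x w i)"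
proof (induction x arbitrary: v w)
  case (Add x y)
  then show ?case by (simp add: algebra_simps)
next
  case (Mul x y)
  then show ?case by simp
qed (auto simp: mat_vec_def fun_eq_iff algebra_simps sum.distrib sum_distrib_left)

lemma act_term_add: "act_term M x (\<lambda>i. v i + w i) = (\<lambda>i. act_term M x v i + act_term M x w i)"
  using act_term_linear[of M x 1 v w] by simp

lemma act_term_zero: "act_term M x (\<lambda>i. 0) = (\<lambda>i. 0)"
  using act_term_linear[of M x "-1" "\<lambda>i. 0" "\<lambda>i. 0"] by simp

lemma act_term_scale: "act_term M x (\<lambda>i. c * v i) = (\<lambda>i. c * act_term M x v i)"
  using act_term_linear[of M x c v "\<lambda>i. 0"] by (simp add: act_term_zero)

lemma act_term_EF:
  assumes M: "weight_module M" and v: "v \<in> vecs M"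
  shows "mat_vec (basis M) (Emat M) (mat_vec (basis M) (Fmat M) v) i
          - mat_vec (basis M) (Fmat M) (mat_vec (basis M) (Emat M) v) i = qint (wt M i) * v i"
proof (cases "i \<in> basis M")
  case False
  with v show ?thesis by (simp add: mat_vec_def vecs_def)
next
  case True
  let ?B = "basis M"
  have fin: "finite ?B" using M by (simp add: weight_module_def)
  have prod: "(\<Sum>k\<in>?B. A k * (\<Sum>j\<in>?B. C k j * v j)) = (\<Sum>j\<in>?B. (\<Sum>k\<in>?B. A k * C k j) * v j)"
    for A C
    by (simp add: sum_distrib_left sum_distrib_right mult.assoc) (rule sum.swap)
  have mv: "mat_vec ?B A (mat_vec ?B C v) i = (\<Sum>j\<in>?B. (\<Sum>k\<in>?B. A i k * C k j) * v j)" for A C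
    using True by (simp add: mat_vec_def prod)
  have "mat_vec ?B (Emat M) (mat_vec ?B (Fmat M) v) i - mat_vec ?B (Fmat M) (mat_vec ?B (Emat M) v) i
      = (\<Sum>j\<in>?B. ((\<Sum>k\<in>?B. Emat M i k * Fmat M k j) - (\<Sum>k\<in>?B. Fmat M i k * Emat M k j)) * v j)"
    by (simp add: mv sum_subtractf left_diff_distrib)
  also have "\<dots> = (\<Sum>j\<in>?B. (if i = j then qint (wt M i) else 0) * v j)"
    using M True by (intro sum.cong) (auto simp: weight_module_def)
  also have "\<dots> = (\<Sum>j\<in>?B. if i = j then qint (wt M i) * v j else 0)"
    by (intro sum.cong) auto
  also have "\<dots> = qint (wt M i) * v i"
    using True fin by simp
  finally show ?thesis .
qed

lemma q_powi_cancel: "q powi n * (q powi (- n) * c) = c" "q powi (- n) * (q powi n * c) = c"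
  by (simp_all only: mult.assoc[symmetric] power_int_add[OF disjI1[OF q_nz], symmetric]
      add.right_inverse add.left_inverse power_int_0_right mult_1)

lemma act_term_ueq:
  assumes "ueq x y" "weight_module M" "v \<in> vecs M"
  shows "act_term M x v = act_term M y v"
  using assms(1,3)
proof (induction arbitrary: v rule: ueq.induct)
  case (ueq_sym x y)
  from ueq_sym.IH[OF ueq_sym.prems] show ?case ..
next
  case (ueq_trans x y z)
  from ueq_trans.IH[OF ueq_trans.prems] show ?case by (rule trans)
next
  case (Add_cong x x' y y')
  then show ?case by simp
next
  case (Mul_cong x x' y y')
  then show ?case by (simp add: act_term_vecs)
next
  case (Mul_Add_right x y z)
  show ?case by (simp add: act_term_add)
next
  case (Scal_central c x)
  show ?case by (simp add: act_term_scale)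
next
  case K_E
  have "q powi wt M i * Emat M i j * v j = q powi 2 * (Emat M i j * (q powi wt M j * v j))"
    if "i \<in> basis M" "j \<in> basis M" for i j
    using that assms(2) by (cases "Emat M i j = 0") (auto simp: weight_module_def power_int_add)
  then show ?case
    by (auto simp: fun_eq_iff mat_vec_def sum_distrib_left mult.assoc intro!: sum.cong)
next
  case K_F
  have "q powi wt M i * Fmat M i j * v j = q powi (- 2) * (Fmat M i j * (q powi wt M j * v j))"
    if "i \<in> basis M" "j \<in> basis M" for i j
  proof (cases "Fmat M i j = 0")
    case False
    then have "wt M i = - 2 + wt M j" using that assms(2) by (auto simp: weight_module_def)
    then show ?thesis by (simp only: power_int_add[OF disjI1[OF q_nz]] mult_ac)
  qed simp
  then show ?case
    by (auto simp: fun_eq_iff mat_vec_def sum_distrib_left mult.assoc intro!: sum.cong)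
next
  case E_F
  have "act_term M (Add (Mul GenE GenF) (Mul (Scal (- 1)) (Mul GenF GenE))) v i = qint (wt M i) * v i" for i
    using act_term_EF[OF assms(2) E_F, of i] by simp
  moreover have "qint n * c = 1 / (q - q powi (- 1)) * (q powi n * c + - 1 * (q powi (- n) * c))" for n c
    unfolding qint_def by (simp only: times_divide_eq_left mult_1 mult_minus_left left_diff_distrib) simp
  ultimately show ?case by (simp add: fun_eq_iff)
next
  case (E_Idem m)
  have "(\<Sum>j\<in>basis M. Emat M i j * (if wt M j = m then v j else 0)) =
      (if wt M i = m + 2 then \<Sum>j\<in>basis M. Emat M i j * v j else 0)" if "i \<in> basis M" for i
    using assms(2) that
    by (fastforce simp: weight_module_def intro!: sum.cong sum.neutral)
  then show ?case by (auto simp: fun_eq_iff mat_vec_def)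
next
  case (F_Idem m)
  have "(\<Sum>j\<in>basis M. Fmat M i j * (if wt M j = m then v j else 0)) =
      (if wt M i = m - 2 then \<Sum>j\<in>basis M. Fmat M i j * v j else 0)" if "i \<in> basis M" for i
    using assms(2) that
    by (fastforce simp: weight_module_def intro!: sum.cong sum.neutral)
  then show ?case by (auto simp: fun_eq_iff mat_vec_def)
next
  case K_Ki
  show ?case by (simp add: q_powi_cancel)
next
  case Ki_K
  show ?case by (simp add: q_powi_cancel)
qed (auto simp: fun_eq_iff algebra_simps)

lemma act_abs: "weight_module M \<Longrightarrow> v \<in> vecs M \<Longrightarrow> act M (abs_uhat x) v = act_term M x v"
  unfolding act_def
  by (rule act_term_ueq) (simp_all add: uhat.abs_eq_iff[symmetric] Quotient_abs_rep[OF Quotient_uhat])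

lemma act_vecs: "v \<in> vecs M \<Longrightarrow> act M u v \<in> vecs M"
  by (simp add: act_def act_term_vecs)

lemma act_simps:
  assumes "weight_module M" "v \<in> vecs M"
  shows "act M (scal c) v = (\<lambda>i. c * v i)"
    and "act M gE v = mat_vec (basis M) (Emat M) v"
    and "act M gF v = mat_vec (basis M) (Fmat M) v"
    and "act M gK v = (\<lambda>i. q powi (wt M i) * v i)"
    and "act M gKi v = (\<lambda>i. q powi (- wt M i) * v i)"
    and "act M (idem m) v = (\<lambda>i. if wt M i = m then v i else 0)"
    and "act M 0 v = (\<lambda>i. 0)"
    and "act M 1 v = v"
    and "act M (x + y) v = (\<lambda>i. act M x v i + act M y v i)"
    and "act M (x * y) v = act M x (act M y v)"
proof -
  show "act M (scal c) v = (\<lambda>i. c * v i)" "act M gE v = mat_vec (basis M) (Emat M) v"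
    "act M gF v = mat_vec (basis M) (Fmat M) v" "act M gK v = (\<lambda>i. q powi (wt M i) * v i)"
    "act M gKi v = (\<lambda>i. q powi (- wt M i) * v i)"
    "act M (idem m) v = (\<lambda>i. if wt M i = m then v i else 0)"
    "act M 0 v = (\<lambda>i. 0)" "act M 1 v = v"
    using assms
    by (simp_all add: scal_def gE_def gF_def gK_def gKi_def idem_def zero_uhat_def one_uhat_def act_abs)
  obtain x' y' where xy: "x = abs_uhat x'" "y = abs_uhat y'"
    by (metis Quotient_abs_rep[OF Quotient_uhat])
  show "act M (x + y) v = (\<lambda>i. act M x v i + act M y v i)" "act M (x * y) v = act M x (act M y v)"
    using assms
    by (simp_all add: xy plus_uhat.abs_eq times_uhat.abs_eq act_abs act_term_vecs)
qed

text \<open>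
  \<open>L(n)\<close> in the basis \<open>F\<^sup>(\<^sup>k\<^sup>) \<eta>\<^sub>n\<close> (\<open>0 \<le> k \<le> n\<close>):
  \<open>E F\<^sup>(\<^sup>k\<^sup>) \<eta>\<^sub>n = [n - k + 1] F\<^sup>(\<^sup>k\<^sup>-\<^sup>1\<^sup>) \<eta>\<^sub>n\<close> and \<open>F F\<^sup>(\<^sup>k\<^sup>) \<eta>\<^sub>n = [k + 1] F\<^sup>(\<^sup>k\<^sup>+\<^sup>1\<^sup>) \<eta>\<^sub>n\<close>.
\<close>

definition L :: "nat \<Rightarrow> nat wmod" where
  "L n = \<lparr>basis = {..n}, wt = (\<lambda>k. int n - 2 * int k),
          Emat = (\<lambda>i k. if k = Suc i then qint (int n - int k + 1) else 0),
          Fmat = (\<lambda>i k. if i = Suc k then qint (int k + 1) else 0)\<rparr>"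

text \<open>The twist by the automorphism \<open>\<omega>\<close> with \<open>E \<mapsto> F\<close>, \<open>F \<mapsto> E\<close>, \<open>K \<mapsto> K\<^sup>-\<^sup>1\<close>.\<close>

definition omega_twist :: "'i wmod \<Rightarrow> 'i wmod" where
  "omega_twist M = \<lparr>basis = basis M, wt = (\<lambda>i. - wt M i), Emat = Fmat M, Fmat = Emat M\<rparr>"

definition omega_L :: "nat \<Rightarrow> nat wmod" where
  "omega_L n = omega_twist (L n)"

text \<open>\<open>\<eta>\<^sub>n \<in> L(n)\<close> and \<open>\<xi>\<^sub>-\<^sub>n \<in> \<^sup>\<omega>L(n)\<close> are both the basis vector with index \<open>0\<close>, for all \<open>n\<close>.\<close>

definition eta :: "nat \<Rightarrow> qf" where "eta = (\<lambda>k. if k = 0 then 1 else 0)"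

definition xi :: "nat \<Rightarrow> qf" where "xi = (\<lambda>k. if k = 0 then 1 else 0)"

text \<open>
  The tensor product module for \<open>\<Delta>(K) = K \<otimes> K\<close>, \<open>\<Delta>(E) = E \<otimes> 1 + K \<otimes> E\<close>,
  \<open>\<Delta>(F) = F \<otimes> K\<^sup>-\<^sup>1 + 1 \<otimes> F\<close>.
\<close>

definition tensor_mod :: "'i wmod \<Rightarrow> 'j wmod \<Rightarrow> ('i \<times> 'j) wmod" where
  "tensor_mod M N = \<lparr>basis = basis M \<times> basis N, wt = (\<lambda>(i, j). wt M i + wt N j),
     Emat = (\<lambda>(i, j) (i', j').
       Emat M i i' * (if j = j' then 1 else 0)
       + (if i = i' then q powi (wt M i) else 0) * Emat N j j'),
     Fmat = (\<lambda>(i, j) (i', j').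
       Fmat M i i' * (if j = j' then q powi (- wt N j) else 0)
       + (if i = i' then 1 else 0) * Fmat N j j')\<rparr>"

definition tensor :: "('i \<Rightarrow> qf) \<Rightarrow> ('j \<Rightarrow> qf) \<Rightarrow> 'i \<times> 'j \<Rightarrow> qf" where
  "tensor v w = (\<lambda>(i, j). v i * w j)"

lemma xi_vecs: "xi \<in> vecs (omega_L p)"
  by (simp add: xi_def vecs_def omega_L_def omega_twist_def L_def)

lemma eta_vecs: "eta \<in> vecs (L n)"
  by (simp add: eta_def vecs_def L_def)

lemma tensor_vecs: "v \<in> vecs M \<Longrightarrow> w \<in> vecs N \<Longrightarrow> tensor v w \<in> vecs (tensor_mod M N)"
  by (auto simp: vecs_def tensor_def tensor_mod_def)


lemma q_sq_ne_1: "q - q powi (- 1) \<noteq> 0"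
proof
  assume "q - q powi (- 1) = 0"
  then have "q = inverse q" by (simp add: power_int_minus)
  then have "q * q = 1" using right_inverse[OF q_nz] by simp
  then show False by (simp add: q_def One_fract_def eq_fract one_pCons)
qed

lemma qint_0 [simp]: "qint 0 = 0"
  by (simp add: qint_def)

lemma qint_minus: "qint (- m) = - qint m"
  by (simp add: qint_def diff_divide_distrib)

lemma qint_add: "qint m * q powi (- n) + q powi m * qint n = qint (m + n)"
proof -
  have "(q powi m - q powi (- m)) * q powi (- n) + q powi m * (q powi n - q powi (- n))
      = q powi (m + n) - q powi (- (m + n))"
    by (simp only: left_diff_distrib right_diff_distrib power_int_add[OF disjI1[OF q_nz]] minus_add_distrib)
  then show ?thesis
    unfolding qint_def by (simp only: times_divide_eq_left times_divide_eq_right add_divide_distrib[symmetric])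
qed

lemma qint_commutator: "qint (m - k) * qint (k + 1) - qint k * qint (m - k + 1) = qint (m - 2 * k)"
proof -
  define x x' y y' d where "x = q powi k" "x' = q powi (- k)" "y = q powi m" "y' = q powi (- m)"
    "d = q - q powi (- 1)"
  note defs = this
  have d: "d \<noteq> 0" "d = q - q powi (- 1)" using q_sq_ne_1 by (simp_all add: defs)
  have pw: "q powi (r + s) = q powi r * q powi s" for r s
    by (simp add: power_int_add)
  have vals: "q powi (m - k) = y * x'" "q powi (- (m - k)) = x * y'"
    "q powi (k + 1) = x * q" "q powi (- (k + 1)) = x' * q powi (- 1)"
    "q powi (m - k + 1) = y * x' * q" "q powi (- (m - k + 1)) = x * y' * q powi (- 1)"
    "q powi (m - 2 * k) = y * x' * x'" "q powi (- (m - 2 * k)) = x * x * y'"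
    unfolding defs
    using pw[of m "- k"] pw[of k "- m"] pw[of k 1] pw[of "- k" "- 1"] pw[of "m - k" 1]
      pw[of "k - m" "- 1"] pw[of "m - k" "- k"] pw[of k "k - m"]
    by (simp_all add: algebra_simps)
  have "(y * x' - x * y') * (x * q - x' * q powi (- 1))
      - (x - x') * (y * x' * q - x * y' * q powi (- 1)) = (y * x' * x' - x * x * y') * d"
    unfolding d(2) by (simp only: algebra_simps)
  then have "((y * x' - x * y') * (x * q - x' * q powi (- 1))
      - (x - x') * (y * x' * q - x * y' * q powi (- 1))) / (d * d) = (y * x' * x' - x * x * y') / d"
    using d(1) by simp
  then show ?thesis
    unfolding qint_def vals d(2)[symmetric] defs(1,2)[symmetric]
    by (simp only: times_divide_times_eq diff_divide_distrib[symmetric])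
qed

lemma weight_module_L: "weight_module (L n)"
proof -
  have "(\<Sum>k\<le>n. Emat (L n) i k * Fmat (L n) k j) - (\<Sum>k\<le>n. Fmat (L n) i k * Emat (L n) k j)
      = (if i = j then qint (wt (L n) i) else 0)" if ij: "i \<le> n" "j \<le> n" for i j
  proof -
    have "(\<Sum>k\<le>n. Emat (L n) i k * Fmat (L n) k j)
        = (\<Sum>k\<le>n. if k = Suc i then (if i = j then qint (int n - int i) * qint (int i + 1) else 0) else 0)"
      by (intro sum.cong) (auto simp: L_def)
    also have "\<dots> = (if i = j then qint (int n - int i) * qint (int i + 1) else 0)"
      using ij by (cases "i = n") auto
    finally have 1: "(\<Sum>k\<le>n. Emat (L n) i k * Fmat (L n) k j)
        = (if i = j then qint (int n - int i) * qint (int i + 1) else 0)" .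
    have "(\<Sum>k\<le>n. Fmat (L n) i k * Emat (L n) k j)
        = (\<Sum>k\<le>n. if k = i - 1 then (if i = j then qint (int i) * qint (int n - int i + 1) else 0) else 0)"
      by (intro sum.cong) (auto simp: L_def add.commute split: nat_diff_split)
    also have "\<dots> = (if i = j then qint (int i) * qint (int n - int i + 1) else 0)"
      using ij by (simp add: le_diff_conv)
    finally have 2: "(\<Sum>k\<le>n. Fmat (L n) i k * Emat (L n) k j)
        = (if i = j then qint (int i) * qint (int n - int i + 1) else 0)" .
    show ?thesis
      unfolding 1 2 using qint_commutator[of "int n" "int i"] by (auto simp: L_def)
  qed
  then show ?thesis
    by (auto simp: weight_module_def L_def split: if_splits)
qed

lemma weight_module_omega_twist:
  assumes "weight_module M"
  shows "weight_module (omega_twist M)"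
proof -
  have *: "b - a = (if P then - c else 0)" if "a - b = (if P then c else 0)" for a b c :: qf and P
    using that by (auto split: if_splits)
  have "\<forall>i\<in>basis M. \<forall>j\<in>basis M.
      (\<Sum>k\<in>basis M. Fmat M i k * Emat M k j) - (\<Sum>k\<in>basis M. Emat M i k * Fmat M k j)
        = (if i = j then - qint (wt M i) else 0)"
    using assms by (intro ballI *) (simp add: weight_module_def)
  moreover have "\<forall>i\<in>basis M. \<forall>j\<in>basis M. Emat M i j \<noteq> 0 \<longrightarrow> wt M i = wt M j + 2"
    "\<forall>i\<in>basis M. \<forall>j\<in>basis M. Fmat M i j \<noteq> 0 \<longrightarrow> wt M i = wt M j - 2"
    using assms by (simp_all add: weight_module_def)
  ultimately show ?thesis
    using assms unfolding weight_module_def omega_twist_def by (auto simp: qint_minus)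
qed

lemma weight_module_omega_L: "weight_module (omega_L n)"
  by (simp add: omega_L_def weight_module_omega_twist weight_module_L)

lemma weight_module_tensor_mod:
  assumes M: "weight_module M" and N: "weight_module N"
  shows "weight_module (tensor_mod M N)"
proof -
  let ?A = "basis M" and ?B = "basis N" and ?T = "tensor_mod M N"
  have fin: "finite ?A" "finite ?B" using M N by (simp_all add: weight_module_def)
  have gen: "(\<Sum>(k, l)\<in>?A \<times> ?B.
        (a i k * (if j = l then \<alpha> j else 0) + (if i = k then \<beta> i else 0) * b j l)
        * (c k i' * (if l = j' then \<gamma> l else 0) + (if k = i' then \<delta> k else 0) * d l j'))
      = (\<Sum>k\<in>?A. a i k * c k i') * (if j = j' then \<alpha> j * \<gamma> j else 0)
        + a i i' * \<delta> i' * (\<alpha> j * d j j')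
        + \<beta> i * c i i' * (b j j' * \<gamma> j')
        + (if i = i' then \<beta> i * \<delta> i else 0) * (\<Sum>l\<in>?B. b j l * d l j')"
    if "i \<in> ?A" "i' \<in> ?A" "j \<in> ?B" "j' \<in> ?B"
    for a c :: "'a \<Rightarrow> 'a \<Rightarrow> qf" and b d :: "'b \<Rightarrow> 'b \<Rightarrow> qf" and \<alpha> \<beta> \<gamma> \<delta> i i' j j'
  proof -
    have t1: "(\<Sum>k\<in>?A. \<Sum>l\<in>?B. if j = l then (if l = j' then a i k * c k i' * (\<alpha> j * \<gamma> j) else 0) else 0)
        = (\<Sum>k\<in>?A. a i k * c k i') * (if j = j' then \<alpha> j * \<gamma> j else 0)"
      using that fin by (simp add: sum_distrib_right)
    have t2: "(\<Sum>k\<in>?A. \<Sum>l\<in>?B. if j = l then (if k = i' then a i i' * \<delta> i' * (\<alpha> j * d j j') else 0) else 0)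
        = a i i' * \<delta> i' * (\<alpha> j * d j j')"
      using that fin by simp
    have t3: "(\<Sum>k\<in>?A. \<Sum>l\<in>?B. if i = k then (if l = j' then \<beta> i * c i i' * (b j j' * \<gamma> j') else 0) else 0)
        = (\<Sum>k\<in>?A. if i = k then \<beta> i * c i i' * (b j j' * \<gamma> j') else 0)"
      using that fin by (intro sum.cong) auto
    have t4: "(\<Sum>k\<in>?A. \<Sum>l\<in>?B. if i = k then (if k = i' then \<beta> i * \<delta> i * (b j l * d l j') else 0) else 0)
        = (\<Sum>k\<in>?A. if i = k then (if i = i' then \<beta> i * \<delta> i * (\<Sum>l\<in>?B. b j l * d l j') else 0) else 0)"
      by (intro sum.cong) (auto simp: sum_distrib_left)
    have "(\<Sum>(k, l)\<in>?A \<times> ?B.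
        (a i k * (if j = l then \<alpha> j else 0) + (if i = k then \<beta> i else 0) * b j l)
        * (c k i' * (if l = j' then \<gamma> l else 0) + (if k = i' then \<delta> k else 0) * d l j'))
      = (\<Sum>k\<in>?A. \<Sum>l\<in>?B.
          (if j = l then (if l = j' then a i k * c k i' * (\<alpha> j * \<gamma> j) else 0) else 0)
        + (if j = l then (if k = i' then a i i' * \<delta> i' * (\<alpha> j * d j j') else 0) else 0)
        + (if i = k then (if l = j' then \<beta> i * c i i' * (b j j' * \<gamma> j') else 0) else 0)
        + (if i = k then (if k = i' then \<beta> i * \<delta> i * (b j l * d l j') else 0) else 0))"
      unfolding sum.cartesian_product by (intro sum.cong) (auto simp: algebra_simps)
    also have "\<dots> = (\<Sum>k\<in>?A. a i k * c k i') * (if j = j' then \<alpha> j * \<gamma> j else 0)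
        + a i i' * \<delta> i' * (\<alpha> j * d j j')
        + \<beta> i * c i i' * (b j j' * \<gamma> j')
        + (if i = i' then \<beta> i * \<delta> i else 0) * (\<Sum>l\<in>?B. b j l * d l j')"
      unfolding sum.distrib t1 t2 t3 t4 using that fin by simp
    finally show ?thesis .
  qed
  have comm: "(\<Sum>k\<in>?A \<times> ?B. Emat ?T (i, j) k * Fmat ?T k (i', j'))
      - (\<Sum>k\<in>?A \<times> ?B. Fmat ?T (i, j) k * Emat ?T k (i', j'))
      = (if i = i' \<and> j = j' then qint (wt M i + wt N j) else 0)"
    if ij: "i \<in> ?A" "i' \<in> ?A" "j \<in> ?B" "j' \<in> ?B" for i i' j j'
  proof -
    let ?EF = "\<Sum>k\<in>?A. Emat M i k * Fmat M k i'" and ?FE = "\<Sum>k\<in>?A. Fmat M i k * Emat M k i'"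
    let ?EF' = "\<Sum>k\<in>?B. Emat N j k * Fmat N k j'" and ?FE' = "\<Sum>k\<in>?B. Fmat N j k * Emat N k j'"
    let ?D = "if j = j' then q powi (- wt N j) else 0"
    let ?D' = "if i = i' then q powi (wt M i) else 0"
    have 1: "(\<Sum>k\<in>?A \<times> ?B. Emat ?T (i, j) k * Fmat ?T k (i', j'))
        = ?EF * ?D + Emat M i i' * Fmat N j j'
          + q powi wt M i * Fmat M i i' * (Emat N j j' * q powi (- wt N j')) + ?D' * ?EF'"
      using gen[OF ij, of "Emat M" "\<lambda>_. 1" "\<lambda>k. q powi wt M k" "Emat N" "Fmat M"
          "\<lambda>l. q powi (- wt N l)" "\<lambda>_. 1" "Fmat N"]
      by (simp add: tensor_mod_def case_prod_unfold cong: if_cong)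
    have 2: "(\<Sum>k\<in>?A \<times> ?B. Fmat ?T (i, j) k * Emat ?T k (i', j'))
        = ?FE * ?D + Fmat M i i' * q powi wt M i' * (q powi (- wt N j) * Emat N j j')
          + Emat M i i' * Fmat N j j' + ?D' * ?FE'"
      using gen[OF ij, of "Fmat M" "\<lambda>l. q powi (- wt N l)" "\<lambda>_. 1" "Fmat N" "Emat M"
          "\<lambda>_. 1" "\<lambda>k. q powi wt M k" "Emat N"]
      by (simp add: tensor_mod_def case_prod_unfold cong: if_cong)
    have cross: "q powi wt M i * Fmat M i i' * (Emat N j j' * q powi (- wt N j'))
        = Fmat M i i' * q powi wt M i' * (q powi (- wt N j) * Emat N j j')"
    proof (cases "Fmat M i i' = 0 \<or> Emat N j j' = 0")
      case False
      then have "wt M i = wt M i' - 2" "wt N j = wt N j' + 2"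
        using M N ij by (auto simp: weight_module_def)
      then have "q powi wt M i * q powi (- wt N j') = q powi wt M i' * q powi (- wt N j)"
        by (simp flip: power_int_add) (rule arg_cong[where f = "power_int q"], simp)
      then show ?thesis by (simp add: mult_ac)
    qed auto
    have M1: "?EF - ?FE = (if i = i' then qint (wt M i) else 0)"
      using M ij by (simp add: weight_module_def)
    have N1: "?EF' - ?FE' = (if j = j' then qint (wt N j) else 0)"
      using N ij by (simp add: weight_module_def)
    have "(\<Sum>k\<in>?A \<times> ?B. Emat ?T (i, j) k * Fmat ?T k (i', j'))
        - (\<Sum>k\<in>?A \<times> ?B. Fmat ?T (i, j) k * Emat ?T k (i', j'))
        = (?EF - ?FE) * ?D + ?D' * (?EF' - ?FE')"
      unfolding 1 2 cross by (simp only: left_diff_distrib right_diff_distrib)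
    also have "\<dots> = (if i = i' \<and> j = j' then qint (wt M i + wt N j) else 0)"
      unfolding M1 N1 using qint_add[of "wt M i" "wt N j"] by auto
    finally show ?thesis .
  qed
  have gradM: "Emat M i i' \<noteq> 0 \<Longrightarrow> wt M i = wt M i' + 2" "Fmat M i i' \<noteq> 0 \<Longrightarrow> wt M i = wt M i' - 2"
    if "i \<in> ?A" "i' \<in> ?A" for i i'
    using M that by (auto simp: weight_module_def)
  have gradN: "Emat N j j' \<noteq> 0 \<Longrightarrow> wt N j = wt N j' + 2" "Fmat N j j' \<noteq> 0 \<Longrightarrow> wt N j = wt N j' - 2"
    if "j \<in> ?B" "j' \<in> ?B" for j j'
    using N that by (auto simp: weight_module_def)
  have E: "wt M i + wt N j = wt M i' + wt N j' + 2"
    if "i \<in> ?A" "i' \<in> ?A" "j \<in> ?B" "j' \<in> ?B" and nz: "Emat ?T (i, j) (i', j') \<noteq> 0" for i i' j j'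
  proof -
    from nz consider "j = j'" "Emat M i i' \<noteq> 0" | "i = i'" "Emat N j j' \<noteq> 0"
      by (cases "j = j' \<and> Emat M i i' \<noteq> 0") (auto simp: tensor_mod_def split: if_splits)
    then show ?thesis using gradM(1) gradN(1) that by cases auto
  qed
  have F: "wt M i + wt N j = wt M i' + wt N j' - 2"
    if "i \<in> ?A" "i' \<in> ?A" "j \<in> ?B" "j' \<in> ?B" and nz: "Fmat ?T (i, j) (i', j') \<noteq> 0" for i i' j j'
  proof -
    from nz consider "j = j'" "Fmat M i i' \<noteq> 0" | "i = i'" "Fmat N j j' \<noteq> 0"
      by (cases "j = j' \<and> Fmat M i i' \<noteq> 0") (auto simp: tensor_mod_def split: if_splits)
    then show ?thesis using gradM(2) gradN(2) that by cases auto
  qed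
  have basis: "basis ?T = ?A \<times> ?B" and wt: "wt ?T (i, j) = wt M i + wt N j" for i j
    by (simp_all add: tensor_mod_def)
  show ?thesis
    unfolding weight_module_def basis
  proof (intro conjI ballI impI)
    show "finite (?A \<times> ?B)" using fin by simp
  next
    fix x y assume xy: "x \<in> ?A \<times> ?B" "y \<in> ?A \<times> ?B"
    show "wt ?T x = wt ?T y + 2" if "Emat ?T x y \<noteq> 0"
      using xy that E by (cases x; cases y) (simp add: wt)
    show "wt ?T x = wt ?T y - 2" if "Fmat ?T x y \<noteq> 0"
      using xy that F by (cases x; cases y) (simp add: wt)
    show "(\<Sum>k\<in>?A \<times> ?B. Emat ?T x k * Fmat ?T k y) - (\<Sum>k\<in>?A \<times> ?B. Fmat ?T x k * Emat ?T k y)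
        = (if x = y then qint (wt ?T x) else 0)"
      using xy comm[of "fst x" "fst y" "snd x" "snd y"] wt[of "fst x" "snd x"]
      by (simp add: mem_Times_iff prod_eq_iff)
  qed
qed

section \<open>Asymptotically zero sequences and the elements \<open>w\<^sub>m(a,b)\<close>\<close>

text \<open>\<open>\<^sup>\<omega>L(p) \<otimes> L(p + m)\<close>, used only for \<open>p + m \<ge> 0\<close>:\<close>

definition TL :: "int \<Rightarrow> nat \<Rightarrow> (nat \<times> nat) wmod" where
  "TL m p = tensor_mod (omega_L p) (L (nat (int p + m)))"

lemma weight_module_TL: "weight_module (TL m p)"
  by (simp add: TL_def weight_module_tensor_mod weight_module_omega_L weight_module_L)

definition small_coeff :: "(nat \<Rightarrow> qf) \<Rightarrow> bool" where
  "small_coeff c \<longleftrightarrow>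
     (\<exists>N f. \<forall>p. c p = (\<Sum>s=1..N. f s * q powi (- 2 * int s * int p)))"

definition asymp_zero :: "int \<Rightarrow> (nat \<Rightarrow> nat \<times> nat \<Rightarrow> qf) \<Rightarrow> bool" where
  "asymp_zero m z \<longleftrightarrow>
     (\<exists>S T c d. finite S \<and> S \<subseteq> Udot \<and> finite T \<and> T \<subseteq> Uplus \<times> Uminus
        \<and> (\<forall>u\<in>S. small_coeff (c u)) \<and> (\<forall>t\<in>T. small_coeff (d t))
        \<and> (\<forall>p. 0 \<le> int p + m \<longrightarrow>
             (\<forall>i. z p i =
                (\<Sum>u\<in>S. c u p * act (TL m p) (u * idem m) (tensor xi eta) i)
                + (\<Sum>(x, y)\<in>T. d (x, y) p
                     * tensor (act (omega_L p) x xi) (act (L (nat (int p + m))) y eta) i))))"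

definition is_w :: "int \<Rightarrow> nat \<Rightarrow> nat \<Rightarrow> uhat \<Rightarrow> bool" where
  "is_w m a b w \<longleftrightarrow> w \<in> Udot_idem m \<and>
     asymp_zero m (\<lambda>p i. act (TL m p) w (tensor xi eta) i
        - tensor (act (omega_L p) (Ediv a) xi) (act (L (nat (int p + m))) (Fdiv b) eta) i)"

text \<open>A definite description: \<open>w\<^sub>m(a,b)\<close> is the unique element with this property.\<close>

definition w_elt :: "int \<Rightarrow> nat \<Rightarrow> nat \<Rightarrow> uhat" where
  "w_elt m a b = (THE w. is_w m a b w)"

end

theory Submission imports Defs begin

text \<open>
  Write \<open>v\<^sub>k\<^sub>,\<^sub>l = E\<^sup>(\<^sup>k\<^sup>)\<xi> \<otimes> F\<^sup>(\<^sup>l\<^sup>)\<eta>\<close>.  These vectors form the chosen basis of \<open>\<^sup>\<omega>L(p) \<otimes> L(p+m)\<close>, and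
  the matrix entries of \<open>E\<close> and \<open>F\<close> in it are polynomials in \<open>t = q\<^sup>-\<^sup>2\<^sup>p\<close> that do not otherwise
  depend on \<open>p\<close>:
    \<open>E v\<^sub>k\<^sub>,\<^sub>l = [k+1] v\<^sub>k\<^sub>+\<^sub>1\<^sub>,\<^sub>l + q\<^sup>2\<^sup>k (q\<^sup>m\<^sup>-\<^sup>l\<^sup>+\<^sup>1 - t q\<^sup>l\<^sup>-\<^sup>m\<^sup>-\<^sup>1)/(q - q\<^sup>-\<^sup>1) v\<^sub>k\<^sub>,\<^sub>l\<^sub>-\<^sub>1\<close>,
  and symmetrically for \<open>F\<close>.  A sequence is asymptotically zero exactly when its coordinates are
  divisible by \<open>t\<close> (\<open>asymp_zero_iff_has_lim_zero\<close>), so working modulo \<open>o(1)\<close> is setting \<open>t = 0\<close>: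
  every sequence \<open>u(\<xi> \<otimes> \<eta>)\<close> has a limit, a finitely supported function of \<open>(k, l)\<close>, and
  \<open>w\<^sub>m(a,b)\<close> is the element of \<open>\<^bold>U\<^sup>. 1\<^sub>m\<close> whose limit is the indicator function of \<open>(a, b)\<close>.

  At \<open>t = 0\<close> the formula for \<open>E\<close> reads as a recursion that expresses \<open>v\<^sub>a\<^sub>+\<^sub>1\<^sub>,\<^sub>b\<close> by \<open>E v\<^sub>a\<^sub>,\<^sub>b\<close> and
  \<open>v\<^sub>a\<^sub>,\<^sub>b\<^sub>-\<^sub>1\<close>.  The sums over \<open>E\<^sup>(\<^sup>a\<^sup>-\<^sup>s\<^sup>) F\<^sup>(\<^sup>b\<^sup>-\<^sup>s\<^sup>)\<close> in the theorem satisfy the very same recursion; this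
  only concerns their coefficients, so that it holds with \<open>E\<close>, \<open>F\<close> replaced by any two elements of
  the algebra (\<open>mult_w_sum\<close>), in particular with \<open>E\<close> and \<open>F\<close> exchanged.  Since the sums start at
  the divided powers, by induction both families have the required limits
  (\<open>vacuum_lim_w_sum_EF\<close>, \<open>vacuum_lim_w_sum_FE\<close>).

  For uniqueness, commuting \<open>F\<close> past \<open>E\<close> shows that the monomials \<open>E\<^sup>i F\<^sup>j 1\<^sub>m\<close> span all multiples of
  \<open>1\<^sub>m\<close>, and the recursion shows that the monomials lie in the span of the first family.  The limits
  of that family are linearly independent, so an element of \<open>\<^bold>U\<^sup>. 1\<^sub>m\<close> with limit zero
  vanishes (\<open>vacuum_lim_zero_imp_zero\<close>).
\<close>

section \<open>Quantum integers\<close>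

lemma q_power_ne_1: "0 < n \<Longrightarrow> q ^ n \<noteq> 1"
proof
  assume n: "0 < n" and "q ^ n = 1"
  have "q ^ n = Fract ([:0, 1:] ^ n) 1"
    by (induction n) (simp_all add: q_def One_fract_def)
  with \<open>q ^ n = 1\<close> have "[:0, 1:] ^ n = (1 :: rat poly)"
    by (simp add: One_fract_def eq_fract)
  then have "degree ([:0, 1:] ^ n :: rat poly) = 0" by simp
  with n show False by (simp add: degree_power_eq)
qed

lemma q_powi_ne_1: "i \<noteq> 0 \<Longrightarrow> q powi i \<noteq> 1"
proof (cases "0 \<le> i")
  case False
  assume "i \<noteq> 0"
  have "q powi i = inverse (q ^ nat (- i))"
    using False by (simp add: power_int_def power_inverse)
  moreover have "q ^ nat (- i) \<noteq> 1" using False by (intro q_power_ne_1) auto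
  ultimately show ?thesis by (metis inverse_eq_1_iff)
qed (simp add: power_int_def q_power_ne_1)

lemma q_powi_add: "q powi (i + j) = q powi i * q powi j"
  by (simp add: power_int_add)

lemma inj_q_powi_neg2: "inj (\<lambda>p. q powi (- 2 * int p))"
proof (rule injI)
  fix x y assume eq: "q powi (- 2 * int x) = q powi (- 2 * int y)"
  have "q powi (- 2 * int x - - 2 * int y) * q powi (- 2 * int y) = q powi (- 2 * int x)"
    by (subst q_powi_add[symmetric]) simp
  then have "q powi (- 2 * int x - - 2 * int y) = 1" using eq by simp
  then have "- 2 * int x - - 2 * int y = 0" using q_powi_ne_1 by blast
  then show "x = y" by simp
qed

lemma qint_nonzero: "i \<noteq> 0 \<Longrightarrow> qint i \<noteq> 0"
proof -
  assume i: "i \<noteq> 0"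
  have "q powi i \<noteq> q powi (- i)"
  proof
    assume "q powi i = q powi (- i)"
    then have "q powi (i + i) = 1" using q_powi_add[of i i] q_powi_add[of i "- i"] by simp
    then show False using q_powi_ne_1[of "i + i"] i by simp
  qed
  then show ?thesis using q_sq_ne_1 by (simp add: qint_def)
qed

lemma qfact_Suc: "qfact (Suc n) = qint (1 + int n) * qfact n"
  by (simp add: qfact_def add.commute)

lemma qpoch_Suc: "qpoch (Suc n) = qpoch n * (1 - q powi (- 2 * int (Suc n)))"
  by (simp add: qpoch_def)

lemma qpoch_nonzero: "qpoch n \<noteq> 0"
  using q_powi_ne_1[of "- 2 * int k" for k] by (force simp: qpoch_def)

section \<open>Polynomials in \<open>q\<^sup>-\<^sup>2\<^sup>p\<close>\<close>

text \<open>
  The sequence \<open>c\<close> is a polynomial in \<open>t = q\<^sup>-\<^sup>2\<^sup>p\<close>, and \<open>a\<close> is its value at \<open>t = 0\<close>, that is, its limit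
  in the \<open>q\<^sup>-\<^sup>1\<close>-adic sense as \<open>p\<close> grows.
\<close>

definition tends :: "(nat \<Rightarrow> qf) \<Rightarrow> qf \<Rightarrow> bool" where
  "tends c a \<longleftrightarrow> (\<exists>P. (\<forall>p. c p = poly P (q powi (- 2 * int p))) \<and> coeff P 0 = a)"

lemma q_powi_neg2_power: "q powi (- 2 * int s * int p) = (q powi (- 2 * int p)) ^ s"
proof -
  have "- 2 * int s * int p = - 2 * int p * int s" by simp
  then show ?thesis by (simp only: power_int_mult power_int_of_nat)
qed

text \<open>
  The coefficients admitted in \<open>o(1)\<close> are the polynomials in \<open>t\<close> without constant term.  Phrased
  with polynomials, closure under products needs no manipulation of double sums.
\<close>

lemma small_coeff_iff_tends: "small_coeff c \<longleftrightarrow> tends c 0"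
proof
  assume "small_coeff c"
  then obtain N f where f: "\<And>p. c p = (\<Sum>s=1..N. f s * q powi (- 2 * int s * int p))"
    unfolding small_coeff_def by blast
  have "c p = poly (\<Sum>s=1..N. monom (f s) s) (q powi (- 2 * int p))" for p
    unfolding f q_powi_neg2_power by (simp add: poly_sum poly_monom)
  moreover have "coeff (\<Sum>s=1..N. monom (f s) s) 0 = 0"
    by (simp add: coeff_sum)
  ultimately show "tends c 0" unfolding tends_def by blast
next
  assume "tends c 0"
  then obtain P where P: "\<And>p. c p = poly P (q powi (- 2 * int p))" "coeff P 0 = 0"
    unfolding tends_def by blast
  have "c p = (\<Sum>s=1..degree P. coeff P s * q powi (- 2 * int s * int p))" for p
    unfolding P(1) poly_altdef q_powi_neg2_power
    by (rule sum.mono_neutral_right) (use P(2) in \<open>auto simp: not_less_eq_eq Suc_le_eq\<close>)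
  then show "small_coeff c" unfolding small_coeff_def by blast
qed

lemma tends_const: "tends (\<lambda>_. a) a"
  unfolding tends_def by (intro exI[of _ "[:a:]"]) simp

lemma tends_t: "tends (\<lambda>p. q powi (- 2 * int p)) 0"
  unfolding tends_def by (intro exI[of _ "[:0, 1:]"]) simp

lemma tends_add:
  assumes "tends c a" "tends d b"
  shows "tends (\<lambda>p. c p + d p) (a + b)"
proof -
  obtain P Q where "\<And>p. c p = poly P (q powi (- 2 * int p))" "coeff P 0 = a"
    "\<And>p. d p = poly Q (q powi (- 2 * int p))" "coeff Q 0 = b"
    using assms unfolding tends_def by blast
  then show ?thesis unfolding tends_def by (intro exI[of _ "P + Q"]) simp
qed

lemma tends_mult:
  assumes "tends c a" "tends d b"
  shows "tends (\<lambda>p. c p * d p) (a * b)"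
proof -
  obtain P Q where "\<And>p. c p = poly P (q powi (- 2 * int p))" "coeff P 0 = a"
    "\<And>p. d p = poly Q (q powi (- 2 * int p))" "coeff Q 0 = b"
    using assms unfolding tends_def by blast
  then show ?thesis unfolding tends_def by (intro exI[of _ "P * Q"]) (simp add: coeff_mult)
qed

text \<open>
  As \<open>q\<close> is not a root of unity, the powers \<open>q\<^sup>-\<^sup>2\<^sup>p\<close> are infinitely many, and a polynomial that
  vanishes at almost all of them is zero.
\<close>

lemma tends_unique:
  assumes "tends c a" "tends d b" and eq: "\<And>p. p0 \<le> p \<Longrightarrow> c p = d p"
  shows "a = b"
proof -
  obtain P Q where PQ: "\<And>p. c p = poly P (q powi (- 2 * int p))" "coeff P 0 = a"
    "\<And>p. d p = poly Q (q powi (- 2 * int p))" "coeff Q 0 = b"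
    using assms(1,2) unfolding tends_def by blast
  have "P - Q = 0"
  proof (rule ccontr)
    assume "P - Q \<noteq> 0"
    then have "finite {x. poly (P - Q) x = 0}" by (rule poly_roots_finite)
    moreover have "(\<lambda>p. q powi (- 2 * int p)) ` {p0..} \<subseteq> {x. poly (P - Q) x = 0}"
      using eq PQ by auto
    ultimately have "finite ((\<lambda>p. q powi (- 2 * int p)) ` {p0..})"
      by (rule rev_finite_subset)
    then have "finite {p0..}"
      by (rule finite_imageD) (rule inj_on_subset[OF inj_q_powi_neg2], simp)
    then show False by (simp add: infinite_Ici)
  qed
  with PQ show ?thesis by simp
qed

text \<open>
  The only \<open>p\<close>-dependent matrix entries of \<open>E\<close> and \<open>F\<close> on the tensor product have this shape: the
  factor \<open>q\<^sup>-\<^sup>p\<close> from the action of \<open>K\<^sup>\<plusminus>\<^sup>1\<close> compensates the growth of the quantum integer.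
\<close>

lemma tends_qint:
  "tends (\<lambda>p. q powi (i - int p) * qint (int p + j)) (q powi (i + j) / (q - q powi (- 1)))"
proof -
  have "q powi (i - int p) * qint (int p + j)
      = 1 / (q - q powi (- 1)) * (q powi (i + j) + (- (q powi (i - j))) * q powi (- 2 * int p))" for p
  proof -
    have "q powi (i - int p) * q powi (int p + j) = q powi (i + j)"
      by (simp flip: q_powi_add)
    moreover have "q powi (i - int p) * q powi (- (int p + j)) = q powi (i - j) * q powi (- 2 * int p)"
      unfolding q_powi_add[symmetric] by (rule arg_cong[where f = "power_int q"]) simp
    ultimately show ?thesis
      unfolding qint_def by (simp only: times_divide_eq_right right_diff_distrib) simp
  qed
  moreover have "tends (\<lambda>p. 1 / (q - q powi (- 1)) * (q powi (i + j) + (- (q powi (i - j))) * q powi (- 2 * int p)))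
     (1 / (q - q powi (- 1)) * (q powi (i + j) + (- (q powi (i - j))) * 0))"
    by (intro tends_mult tends_add tends_const tends_t)
  ultimately show ?thesis by simp
qed

section \<open>Limits of sequences of vectors\<close>

text \<open>
  The coordinate functions \<open>d k l\<close> are polynomial in \<open>t\<close> for all \<open>p\<close>, while the vector \<open>z p\<close> sees
  only those inside the basis of the \<open>p\<close>-th module.  The bound \<open>N\<close> makes the support finite uniformly
  in \<open>p\<close>, as required of the finite sets in the definition of \<open>o(1)\<close>.
\<close>

definition has_lim :: "int \<Rightarrow> (nat \<Rightarrow> nat \<times> nat \<Rightarrow> qf) \<Rightarrow> (nat \<Rightarrow> nat \<Rightarrow> qf) \<Rightarrow> bool" where
  "has_lim m z \<gamma> \<longleftrightarrow> (\<exists>d N. (\<forall>k l. tends (d k l) (\<gamma> k l))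
     \<and> (\<forall>k l. N < k + l \<longrightarrow> d k l = (\<lambda>_. 0))
     \<and> (\<forall>p. 0 \<le> int p + m \<longrightarrow>
          (\<forall>k l. z p (k, l) = (if k \<le> p \<and> int l \<le> int p + m then d k l p else 0))))"

lemma has_limI:
  assumes "\<And>k l. tends (d k l) (\<gamma> k l)" "\<And>k l. N < k + l \<Longrightarrow> d k l = (\<lambda>_. 0)"
    "\<And>p k l. 0 \<le> int p + m \<Longrightarrow> z p (k, l) = (if k \<le> p \<and> int l \<le> int p + m then d k l p else 0)"
  shows "has_lim m z \<gamma>"
  using assms unfolding has_lim_def by blast

lemma has_limE:
  assumes "has_lim m z \<gamma>"
  obtains d N where "\<And>k l. tends (d k l) (\<gamma> k l)" "\<And>k l. N < k + l \<Longrightarrow> d k l = (\<lambda>_. 0)"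
    "\<And>p k l. 0 \<le> int p + m \<Longrightarrow> z p (k, l) = (if k \<le> p \<and> int l \<le> int p + m then d k l p else 0)"
  using assms unfolding has_lim_def by blast

lemma has_lim_cong:
  "has_lim m z \<gamma> \<Longrightarrow> (\<And>p. 0 \<le> int p + m \<Longrightarrow> z' p = z p) \<Longrightarrow> has_lim m z' \<gamma>"
  unfolding has_lim_def by auto

lemma has_lim_zero: "has_lim m (\<lambda>p i. 0) (\<lambda>k l. 0)"
  by (rule has_limI[where d = "\<lambda>_ _ _. 0" and N = 0]) (simp_all add: tends_const)

lemma has_lim_add_mult:
  assumes "tends c a" "has_lim m z \<gamma>" "has_lim m y \<delta>"
  shows "has_lim m (\<lambda>p i. c p * z p i + y p i) (\<lambda>k l. a * \<gamma> k l + \<delta> k l)"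
proof -
  obtain d N where d: "\<And>k l. tends (d k l) (\<gamma> k l)" "\<And>k l. N < k + l \<Longrightarrow> d k l = (\<lambda>_. 0)"
    "\<And>p k l. 0 \<le> int p + m \<Longrightarrow> z p (k, l) = (if k \<le> p \<and> int l \<le> int p + m then d k l p else 0)"
    using assms(2) by (rule has_limE) blast
  obtain e M where e: "\<And>k l. tends (e k l) (\<delta> k l)" "\<And>k l. M < k + l \<Longrightarrow> e k l = (\<lambda>_. 0)"
    "\<And>p k l. 0 \<le> int p + m \<Longrightarrow> y p (k, l) = (if k \<le> p \<and> int l \<le> int p + m then e k l p else 0)"
    using assms(3) by (rule has_limE) blast
  show ?thesis
    by (rule has_limI[where d = "\<lambda>k l p. c p * d k l p + e k l p" and N = "max N M"],
        intro tends_add tends_mult assms(1) d(1) e(1)) (auto simp: d(2,3) e(2,3))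
qed

lemma has_lim_mult:
  assumes "tends c a" "has_lim m z \<gamma>"
  shows "has_lim m (\<lambda>p i. c p * z p i) (\<lambda>k l. a * \<gamma> k l)"
  using has_lim_add_mult[OF assms has_lim_zero] by simp

lemma has_lim_add:
  assumes "has_lim m z \<gamma>" "has_lim m y \<delta>"
  shows "has_lim m (\<lambda>p i. z p i + y p i) (\<lambda>k l. \<gamma> k l + \<delta> k l)"
  using has_lim_add_mult[OF tends_const[of 1] assms] by simp

lemma has_lim_sum:
  assumes "finite A" "\<And>x. x \<in> A \<Longrightarrow> has_lim m (z x) (\<gamma> x)"
  shows "has_lim m (\<lambda>p i. \<Sum>x\<in>A. z x p i) (\<lambda>k l. \<Sum>x\<in>A. \<gamma> x k l)"
  using assms by (induction A) (simp_all add: has_lim_zero has_lim_add)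

lemma has_lim_unique:
  assumes "has_lim m z \<gamma>" "has_lim m z \<delta>"
  shows "\<gamma> = \<delta>"
proof (intro ext)
  fix k l
  obtain d N where d: "\<And>k l. tends (d k l) (\<gamma> k l)"
    "\<And>p k l. 0 \<le> int p + m \<Longrightarrow> z p (k, l) = (if k \<le> p \<and> int l \<le> int p + m then d k l p else 0)"
    using assms(1) by (rule has_limE) blast
  obtain e M where e: "\<And>k l. tends (e k l) (\<delta> k l)"
    "\<And>p k l. 0 \<le> int p + m \<Longrightarrow> z p (k, l) = (if k \<le> p \<and> int l \<le> int p + m then e k l p else 0)"
    using assms(2) by (rule has_limE) blast
  show "\<gamma> k l = \<delta> k l"
  proof (rule tends_unique[OF d(1) e(1)])
    fix p assume "k + l + nat \<bar>m\<bar> \<le> p"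
    then have "0 \<le> int p + m" "k \<le> p" "int l \<le> int p + m" by auto
    then show "d k l p = e k l p" using d(2)[of p k l] e(2)[of p k l] by simp
  qed
qed

section \<open>The action of the algebra on limits\<close>

lemma basis_TL: "0 \<le> int p + m \<Longrightarrow> (k, l) \<in> basis (TL m p) \<longleftrightarrow> k \<le> p \<and> int l \<le> int p + m"
  by (auto simp: TL_def tensor_mod_def omega_L_def omega_twist_def L_def)

lemma wt_TL: "0 \<le> int p + m \<Longrightarrow> wt (TL m p) (k, l) = m + 2 * int k - 2 * int l"
  by (simp add: TL_def tensor_mod_def omega_L_def omega_twist_def L_def)

lemma has_lim_vecs: "has_lim m z \<gamma> \<Longrightarrow> 0 \<le> int p + m \<Longrightarrow> z p \<in> vecs (TL m p)"
  by (erule has_limE) (auto simp: vecs_def basis_TL)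

text \<open>
  At the boundary of the basis no case distinction is needed: a coordinate outside the basis is zero
  on vectors of the module, and for \<open>k = 0\<close> the truncated index \<open>k - 1\<close> is harmless because \<open>[0] = 0\<close>.
\<close>

lemma TL_act_E:
  assumes p: "0 \<le> int p + m" and v: "v \<in> vecs (TL m p)"
  shows "act (TL m p) gE v (k, l) = (if k \<le> p \<and> int l \<le> int p + m
    then qint (int k) * v (k - 1, l) + q powi (2 * int k - int p) * qint (int p + (m - int l)) * v (k, Suc l)
    else 0)"
proof (cases "k \<le> p \<and> int l \<le> int p + m")
  case True
  let ?M = "TL m p"
  have fin: "finite (basis ?M)" using weight_module_TL[of m p] by (simp add: weight_module_def)
  have "act ?M gE v (k, l) = (\<Sum>j\<in>basis ?M. Emat ?M (k, l) j * v j)"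
    using True p by (simp add: act_simps(2)[OF weight_module_TL v] mat_vec_def basis_TL)
  also have "\<dots> = (\<Sum>j\<in>basis ?M. (if j = (k - 1, l) then qint (int k) * v (k - 1, l) else 0)
     + (if j = (k, Suc l) then q powi (2 * int k - int p) * qint (int p + (m - int l)) * v (k, Suc l) else 0))"
  proof (rule sum.cong)
    fix j assume "j \<in> basis ?M"
    obtain k' l' where j: "j = (k', l')" by force
    show "Emat ?M (k, l) j * v j = (if j = (k - 1, l) then qint (int k) * v (k - 1, l) else 0)
     + (if j = (k, Suc l) then q powi (2 * int k - int p) * qint (int p + (m - int l)) * v (k, Suc l) else 0)"
      unfolding j using p
      by (cases k)
        (auto simp: TL_def tensor_mod_def omega_L_def omega_twist_def L_def algebra_simps)
  qed simp
  also have "\<dots> = (if (k - 1, l) \<in> basis ?M then qint (int k) * v (k - 1, l) else 0)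
     + (if (k, Suc l) \<in> basis ?M then q powi (2 * int k - int p) * qint (int p + (m - int l)) * v (k, Suc l) else 0)"
    using fin by (simp add: sum.distrib)
  also have "\<dots> = qint (int k) * v (k - 1, l) + q powi (2 * int k - int p) * qint (int p + (m - int l)) * v (k, Suc l)"
    using v by (auto simp: vecs_def)
  finally show ?thesis using True by simp
next
  case False
  then show ?thesis
    using act_vecs[OF v, of gE] p by (auto simp: vecs_def basis_TL)
qed

lemma TL_act_F:
  assumes p: "0 \<le> int p + m" and v: "v \<in> vecs (TL m p)"
  shows "act (TL m p) gF v (k, l) = (if k \<le> p \<and> int l \<le> int p + m
    then qint (int l) * v (k, l - 1) + q powi (2 * int l - m - int p) * qint (int p + - int k) * v (Suc k, l)
    else 0)"
proof (cases "k \<le> p \<and> int l \<le> int p + m")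
  case True
  let ?M = "TL m p"
  have fin: "finite (basis ?M)" using weight_module_TL[of m p] by (simp add: weight_module_def)
  have "act ?M gF v (k, l) = (\<Sum>j\<in>basis ?M. Fmat ?M (k, l) j * v j)"
    using True p by (simp add: act_simps(3)[OF weight_module_TL v] mat_vec_def basis_TL)
  also have "\<dots> = (\<Sum>j\<in>basis ?M. (if j = (k, l - 1) then qint (int l) * v (k, l - 1) else 0)
     + (if j = (Suc k, l) then q powi (2 * int l - m - int p) * qint (int p + - int k) * v (Suc k, l) else 0))"
  proof (rule sum.cong)
    fix j assume "j \<in> basis ?M"
    obtain k' l' where j: "j = (k', l')" by force
    show "Fmat ?M (k, l) j * v j = (if j = (k, l - 1) then qint (int l) * v (k, l - 1) else 0)
     + (if j = (Suc k, l) then q powi (2 * int l - m - int p) * qint (int p + - int k) * v (Suc k, l) else 0)"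
      unfolding j using p
      by (cases l)
        (auto simp: TL_def tensor_mod_def omega_L_def omega_twist_def L_def algebra_simps)
  qed simp
  also have "\<dots> = (if (k, l - 1) \<in> basis ?M then qint (int l) * v (k, l - 1) else 0)
     + (if (Suc k, l) \<in> basis ?M then q powi (2 * int l - m - int p) * qint (int p + - int k) * v (Suc k, l) else 0)"
    using fin by (simp add: sum.distrib)
  also have "\<dots> = qint (int l) * v (k, l - 1) + q powi (2 * int l - m - int p) * qint (int p + - int k) * v (Suc k, l)"
    using v by (auto simp: vecs_def)
  finally show ?thesis using True by simp
next
  case False
  then show ?thesis
    using act_vecs[OF v, of gF] p by (auto simp: vecs_def basis_TL)
qed

text \<open>
  The coordinate function \<open>d k (l + 1)\<close> need not vanish where \<open>l + 1\<close> leaves the basis, that is for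
  \<open>l = p + m\<close>; but there its coefficient is a multiple of \<open>[p + m - l] = 0\<close>.
\<close>

lemma has_lim_E:
  assumes z: "has_lim m z \<gamma>"
  shows "has_lim m (\<lambda>p. act (TL m p) gE (z p)) (\<lambda>k l. qint (int k) * \<gamma> (k - 1) l
    + q powi (2 * int k + (m - int l)) / (q - q powi (- 1)) * \<gamma> k (Suc l))"
proof -
  obtain d N where d: "\<And>k l. tends (d k l) (\<gamma> k l)" "\<And>k l. N < k + l \<Longrightarrow> d k l = (\<lambda>_. 0)"
    "\<And>p k l. 0 \<le> int p + m \<Longrightarrow> z p (k, l) = (if k \<le> p \<and> int l \<le> int p + m then d k l p else 0)"
    using z by (rule has_limE) blast
  show ?thesis
  proof (rule has_limI[where N = "Suc N" and d = "\<lambda>k l p. qint (int k) * d (k - 1) l p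
    + q powi (2 * int k - int p) * qint (int p + (m - int l)) * d k (Suc l) p"])
    fix p k l assume p: "0 \<le> int p + m"
    show "act (TL m p) gE (z p) (k, l) = (if k \<le> p \<and> int l \<le> int p + m
      then qint (int k) * d (k - 1) l p
        + q powi (2 * int k - int p) * qint (int p + (m - int l)) * d k (Suc l) p else 0)"
      unfolding TL_act_E[OF p has_lim_vecs[OF z p]]
      by (cases "int l = int p + m") (auto simp: d(3)[OF p])
  next
    fix k l assume "Suc N < k + l"
    then show "(\<lambda>p. qint (int k) * d (k - 1) l p
        + q powi (2 * int k - int p) * qint (int p + (m - int l)) * d k (Suc l) p) = (\<lambda>_. 0)"
      by (auto simp: d(2) fun_eq_iff)
  qed (intro tends_add tends_mult tends_const tends_qint d(1))
qed

lemma has_lim_F: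
  assumes z: "has_lim m z \<gamma>"
  shows "has_lim m (\<lambda>p. act (TL m p) gF (z p)) (\<lambda>k l. qint (int l) * \<gamma> k (l - 1)
    + q powi (2 * int l - m + - int k) / (q - q powi (- 1)) * \<gamma> (Suc k) l)"
proof -
  obtain d N where d: "\<And>k l. tends (d k l) (\<gamma> k l)" "\<And>k l. N < k + l \<Longrightarrow> d k l = (\<lambda>_. 0)"
    "\<And>p k l. 0 \<le> int p + m \<Longrightarrow> z p (k, l) = (if k \<le> p \<and> int l \<le> int p + m then d k l p else 0)"
    using z by (rule has_limE) blast
  show ?thesis
  proof (rule has_limI[where N = "Suc N" and d = "\<lambda>k l p. qint (int l) * d k (l - 1) p
    + q powi (2 * int l - m - int p) * qint (int p + - int k) * d (Suc k) l p"])
    fix p k l assume p: "0 \<le> int p + m"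
    show "act (TL m p) gF (z p) (k, l) = (if k \<le> p \<and> int l \<le> int p + m
      then qint (int l) * d k (l - 1) p
        + q powi (2 * int l - m - int p) * qint (int p + - int k) * d (Suc k) l p else 0)"
      unfolding TL_act_F[OF p has_lim_vecs[OF z p]]
      by (cases "k = p") (auto simp: d(3)[OF p])
  next
    fix k l assume "Suc N < k + l"
    then show "(\<lambda>p. qint (int l) * d k (l - 1) p
        + q powi (2 * int l - m - int p) * qint (int p + - int k) * d (Suc k) l p) = (\<lambda>_. 0)"
      by (auto simp: d(2) fun_eq_iff)
  qed (intro tends_add tends_mult tends_const tends_qint d(1))
qed

text \<open>
  The weight of \<open>v\<^sub>k\<^sub>,\<^sub>l\<close> does not depend on \<open>p\<close>, so \<open>K\<close>, \<open>K\<^sup>-\<^sup>1\<close> and the idempotents act on limits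
  by the same diagonal matrices.
\<close>

lemma has_lim_weight:
  assumes "has_lim m z \<gamma>"
  shows "has_lim m (\<lambda>p i. f (wt (TL m p) i) * z p i) (\<lambda>k l. f (m + 2 * int k - 2 * int l) * \<gamma> k l)"
proof -
  obtain d N where d: "\<And>k l. tends (d k l) (\<gamma> k l)" "\<And>k l. N < k + l \<Longrightarrow> d k l = (\<lambda>_. 0)"
    "\<And>p k l. 0 \<le> int p + m \<Longrightarrow> z p (k, l) = (if k \<le> p \<and> int l \<le> int p + m then d k l p else 0)"
    using assms by (rule has_limE) blast
  show ?thesis
    by (rule has_limI[where d = "\<lambda>k l p. f (m + 2 * int k - 2 * int l) * d k l p" and N = N])
      (auto intro: tends_mult tends_const d(1) simp: d(2,3) wt_TL)
qed

lemma uhat_induct [case_names scal gE gF gK gKi idem add mult]: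
  assumes "\<And>c. P (scal c)" "P gE" "P gF" "P gK" "P gKi" "\<And>n. P (idem n)"
    "\<And>x y. P x \<Longrightarrow> P y \<Longrightarrow> P (x + y)" "\<And>x y. P x \<Longrightarrow> P y \<Longrightarrow> P (x * y)"
  shows "P u"
proof -
  have "P (abs_uhat t)" for t
    using assms
    by (induction t)
      (simp_all add: scal_def gE_def gF_def gK_def gKi_def idem_def
        flip: plus_uhat.abs_eq times_uhat.abs_eq)
  then show ?thesis by (metis Quotient_abs_rep[OF Quotient_uhat])
qed

lemma has_lim_act: "has_lim m z \<gamma> \<Longrightarrow> \<exists>\<delta>. has_lim m (\<lambda>p. act (TL m p) u (z p)) \<delta>"
proof (induction u arbitrary: z \<gamma> rule: uhat_induct)
  case (scal c)
  show ?case
    by (rule exI, rule has_lim_cong[OF has_lim_mult[OF tends_const[of c] scal]])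
      (simp add: act_simps(1)[OF weight_module_TL has_lim_vecs[OF scal]])
next
  case gK
  show ?case
    by (rule exI, rule has_lim_cong[OF has_lim_weight[OF gK, of "\<lambda>i. q powi i"]])
      (simp add: act_simps(4)[OF weight_module_TL has_lim_vecs[OF gK]])
next
  case gKi
  show ?case
    by (rule exI, rule has_lim_cong[OF has_lim_weight[OF gKi, of "\<lambda>i. q powi (- i)"]])
      (simp add: act_simps(5)[OF weight_module_TL has_lim_vecs[OF gKi]])
next
  case (idem n)
  show ?case
    by (rule exI, rule has_lim_cong[OF has_lim_weight[OF idem, of "\<lambda>i. if i = n then 1 else 0"]])
      (auto simp: act_simps(6)[OF weight_module_TL has_lim_vecs[OF idem]])
next
  case (add x y)
  obtain \<gamma>1 \<gamma>2 where "has_lim m (\<lambda>p. act (TL m p) x (z p)) \<gamma>1" "has_lim m (\<lambda>p. act (TL m p) y (z p)) \<gamma>2"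
    using add by blast
  from has_lim_add[OF this] show ?case
    by (intro exI, rule has_lim_cong) (simp add: act_simps(9)[OF weight_module_TL has_lim_vecs[OF add.prems]])
next
  case (mult x y)
  obtain \<gamma>1 where "has_lim m (\<lambda>p. act (TL m p) y (z p)) \<gamma>1" using mult by blast
  then obtain \<gamma>2 where "has_lim m (\<lambda>p. act (TL m p) x (act (TL m p) y (z p))) \<gamma>2"
    using mult.IH(1) by blast
  then show ?case
    by (intro exI, rule has_lim_cong) (simp add: act_simps(10)[OF weight_module_TL has_lim_vecs[OF mult.prems]])
qed (blast intro: has_lim_E has_lim_F)+


section \<open>Divided powers on extremal weight vectors\<close>

definition trunc :: "nat \<Rightarrow> (nat \<Rightarrow> qf) \<Rightarrow> nat \<Rightarrow> qf" where
  "trunc n c = (\<lambda>k. if k \<le> n then c k else 0)"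

definition unit_at :: "nat \<Rightarrow> nat \<Rightarrow> qf" where
  "unit_at a = (\<lambda>k. if k = a then 1 else 0)"

lemma scal_left_commute: "x * (scal c * y) = scal c * (x * y)"
  by (metis mult.assoc scal_central)

definition dpow :: "uhat \<Rightarrow> nat \<Rightarrow> uhat" where
  "dpow X a = scal (1 / qfact a) * X ^ a"

lemma dpow_0 [simp]: "dpow X 0 = 1"
  by (simp add: dpow_def qfact_def)

lemma Ediv_eq_dpow: "Ediv = dpow gE"
  by (simp add: fun_eq_iff Ediv_def dpow_def)

lemma Fdiv_eq_dpow: "Fdiv = dpow gF"
  by (simp add: fun_eq_iff Fdiv_def dpow_def)

lemma mult_dpow: "X * dpow X a = scal (qint (1 + int a)) * dpow X (Suc a)"
proof -
  have "X * dpow X a = scal (1 / qfact a) * X ^ Suc a"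
    by (simp add: dpow_def scal_left_commute[of X])
  also have "1 / qfact a = qint (1 + int a) * (1 / qfact (Suc a))"
    using qint_nonzero[of "1 + int a"] by (simp add: qfact_Suc)
  finally show ?thesis by (simp only: dpow_def scal_mult mult.assoc)
qed

lemma dpow_Suc: "dpow X (Suc a) = scal (1 / qint (1 + int a)) * (X * dpow X a)"
  using qint_nonzero[of "1 + int a"] by (simp add: mult_dpow mult.assoc[symmetric] flip: scal_mult)

lemma dpow_in_subalg: "dpow X a \<in> subalg {X}"
proof -
  have "X ^ a \<in> subalg {X}"
  proof (induction a)
    case 0
    show ?case using subalg_scal[of 1] by simp
  qed (auto intro: subalg.intros)
  then show ?thesis by (simp add: dpow_def subalg_mult subalg_scal)
qed

text \<open>
  In the basis of divided powers, \<open>E\<close> on \<open>\<^sup>\<omega>L(n)\<close> and \<open>F\<close> on \<open>L(n)\<close> have the same matrix.  The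
  locale treats both at once; \<open>X\<close> is the generator that moves away from the extremal weight vector.
\<close>

locale cyclic_family =
  fixes M :: "nat \<Rightarrow> nat wmod" and X :: uhat
  assumes weight: "weight_module (M n)" and basis: "basis (M n) = {..n}"
    and act: "v \<in> vecs (M n) \<Longrightarrow> act (M n) X v = mat_vec {..n} (Fmat (L n)) v"
begin

lemma trunc_vecs: "trunc n c \<in> vecs (M n)"
  by (simp add: vecs_def basis trunc_def)

lemma act_trunc: "act (M n) X (trunc n c) = trunc n (\<lambda>k. qint (int k) * c (k - 1))"
proof
  fix k
  have "(\<Sum>j\<le>n. Fmat (L n) k j * trunc n c j) = qint (int k) * c (k - 1)" if "k \<le> n"
  proof -
    have "(\<Sum>j\<le>n. Fmat (L n) k j * trunc n c j)
        = (\<Sum>j\<le>n. if j = k - 1 then qint (int k) * c (k - 1) else 0)"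
      by (intro sum.cong refl, cases k) (auto simp: L_def trunc_def add.commute)
    then show ?thesis using that by simp
  qed
  then show "act (M n) X (trunc n c) k = trunc n (\<lambda>k. qint (int k) * c (k - 1)) k"
    by (simp add: act[OF trunc_vecs] mat_vec_def) (simp add: trunc_def)
qed

text \<open>
  The coefficients of \<open>x \<xi>\<close> (or \<open>y \<eta>\<close>) are independent of \<open>n\<close>, apart from the truncation to the basis.
\<close>

lemma act_subalg:
  assumes "x \<in> subalg {X}" "\<And>k. N < k \<Longrightarrow> c k = 0"
  shows "\<exists>c' N'. (\<forall>k>N'. c' k = 0) \<and> (\<forall>n. act (M n) x (trunc n c) = trunc n c')"
  using assms
proof (induction arbitrary: c N)
  case (subalg_gen x)
  then show ?case
    by (intro exI[of _ "\<lambda>k. qint (int k) * c (k - 1)"] exI[of _ "Suc N"]) (auto simp: act_trunc)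
next
  case (subalg_scal b)
  then show ?case
    by (intro exI[of _ "\<lambda>k. b * c k"] exI[of _ N])
      (simp only: act_simps(1)[OF weight trunc_vecs], auto simp: trunc_def)
next
  case (subalg_add x y)
  obtain c1 N1 where 1: "\<forall>k>N1. c1 k = 0" "\<forall>n. act (M n) x (trunc n c) = trunc n c1"
    using subalg_add.IH(1)[of N c] subalg_add.prems by blast
  obtain c2 N2 where 2: "\<forall>k>N2. c2 k = 0" "\<forall>n. act (M n) y (trunc n c) = trunc n c2"
    using subalg_add.IH(2)[of N c] subalg_add.prems by blast
  show ?case
    by (intro exI[of _ "\<lambda>k. c1 k + c2 k"] exI[of _ "max N1 N2"])
      (simp only: act_simps(9)[OF weight trunc_vecs] 1(2) 2(2), use 1 2 in \<open>auto simp: trunc_def\<close>)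
next
  case (subalg_mult x y)
  obtain c2 N2 where 2: "\<forall>k>N2. c2 k = 0" "\<forall>n. act (M n) y (trunc n c) = trunc n c2"
    using subalg_mult.IH(2)[of N c] subalg_mult.prems by blast
  obtain c1 N1 where "\<forall>k>N1. c1 k = 0" "\<forall>n. act (M n) x (trunc n c2) = trunc n c1"
    using subalg_mult.IH(1)[of N2 c2] 2(1) by blast
  with 2(2) show ?case
    by (intro exI[of _ c1] exI[of _ N1]) (simp add: act_simps(10)[OF weight trunc_vecs])
qed

lemma act_dpow: "act (M n) (dpow X a) (trunc n (unit_at 0)) = trunc n (unit_at a)"
proof (induction a)
  case 0
  show ?case by (simp add: act_simps(8)[OF weight trunc_vecs])
next
  case (Suc a)
  have "act (M n) (dpow X (Suc a)) (trunc n (unit_at 0))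
      = (\<lambda>k. 1 / qint (1 + int a) * trunc n (\<lambda>k. qint (int k) * unit_at a (k - 1)) k)"
    by (simp add: dpow_Suc act_simps(10)[OF weight trunc_vecs] Suc act_trunc
        act_simps(1)[OF weight trunc_vecs])
  also have "\<dots> = trunc n (unit_at (Suc a))"
  proof
    fix k
    show "1 / qint (1 + int a) * trunc n (\<lambda>k. qint (int k) * unit_at a (k - 1)) k = trunc n (unit_at (Suc a)) k"
      using qint_nonzero[of "1 + int a"] by (cases k) (auto simp: trunc_def unit_at_def)
  qed
  finally show ?case .
qed

text \<open>
  Distinct exponents are told apart by a module large enough to contain both basis vectors.
\<close>

lemma inj_dpow: "inj (dpow X)"
proof (rule injI)
  fix a b assume "dpow X a = dpow X b"
  then have "trunc (a + b) (unit_at a) a = trunc (a + b) (unit_at b) a"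
    using act_dpow[of "a + b"] by metis
  then show "a = b" by (simp add: trunc_def unit_at_def split: if_splits)
qed

end

interpretation E: cyclic_family omega_L gE
  by unfold_locales
    (simp_all add: weight_module_omega_L act_simps(2), simp_all add: omega_L_def omega_twist_def L_def)

interpretation F: cyclic_family L gF
  by unfold_locales (simp_all add: weight_module_L act_simps(3), simp_all add: L_def)

lemma xi_eq_trunc: "xi = trunc n (unit_at 0)"
  by (auto simp: xi_def trunc_def unit_at_def)

lemma eta_eq_trunc: "eta = trunc n (unit_at 0)"
  by (auto simp: eta_def trunc_def unit_at_def)

section \<open>Asymptotically zero means limit zero\<close>

definition pure_tensor :: "int \<Rightarrow> uhat \<Rightarrow> uhat \<Rightarrow> nat \<Rightarrow> nat \<times> nat \<Rightarrow> qf" where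
  "pure_tensor m x y p = tensor (act (omega_L p) x xi) (act (L (nat (int p + m))) y eta)"

lemma has_lim_pure_tensor:
  assumes "x \<in> Uplus" "y \<in> Uminus"
  shows "\<exists>\<gamma>. has_lim m (pure_tensor m x y) \<gamma>"
proof -
  obtain c N where c: "\<forall>k>N. c k = 0" "\<forall>n. act (omega_L n) x (trunc n (unit_at 0)) = trunc n c"
    using E.act_subalg[OF assms(1)[unfolded Uplus_def], of 0 "unit_at 0"] by (auto simp: unit_at_def)
  obtain d M where d: "\<forall>k>M. d k = 0" "\<forall>n. act (L n) y (trunc n (unit_at 0)) = trunc n d"
    using F.act_subalg[OF assms(2)[unfolded Uminus_def], of 0 "unit_at 0"] by (auto simp: unit_at_def)
  have "has_lim m (pure_tensor m x y) (\<lambda>k l. c k * d l)"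
  proof (rule has_limI[where d = "\<lambda>k l _. c k * d l" and N = "N + M"])
    fix k l assume "N + M < k + l"
    then have "N < k \<or> M < l" by linarith
    then show "(\<lambda>_. c k * d l) = (\<lambda>_. 0)" using c(1) d(1) by auto
  next
    fix p k l assume "0 \<le> int p + m"
    then show "pure_tensor m x y p (k, l) = (if k \<le> p \<and> int l \<le> int p + m then c k * d l else 0)"
      by (simp add: pure_tensor_def tensor_def xi_eq_trunc[of p] eta_eq_trunc[of "nat (int p + m)"] c(2) d(2))
        (simp add: trunc_def le_nat_iff)
  qed (rule tends_const)
  then show ?thesis by blast
qed

lemma pure_tensor_divided_powers:
  "0 \<le> int p + m \<Longrightarrow> pure_tensor m (Ediv a) (Fdiv b) p (k, l)
     = (if k \<le> p \<and> int l \<le> int p + m then unit_at a k * unit_at b l else 0)"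
  by (simp add: pure_tensor_def tensor_def xi_eq_trunc[of p] eta_eq_trunc[of "nat (int p + m)"]
      Ediv_eq_dpow Fdiv_eq_dpow E.act_dpow F.act_dpow)
    (simp add: trunc_def le_nat_iff)

lemma has_lim_pure_tensor_divided_powers:
  "has_lim m (pure_tensor m (Ediv a) (Fdiv b)) (\<lambda>k l. unit_at a k * unit_at b l)"
  by (rule has_limI[where N = "a + b" and d = "\<lambda>k l _. unit_at a k * unit_at b l"])
    (simp_all add: pure_tensor_divided_powers tends_const unit_at_def)

lemma has_lim_vacuum: "has_lim m (\<lambda>p. tensor xi eta) (\<lambda>k l. unit_at 0 k * unit_at 0 l)"
  by (rule has_lim_cong[OF has_lim_pure_tensor_divided_powers])
    (simp add: pure_tensor_def Ediv_eq_dpow Fdiv_eq_dpow act_simps(8) weight_module_L weight_module_omega_L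
      xi_vecs eta_vecs)

lemma vacuum_vecs: "tensor xi eta \<in> vecs (TL m p)"
  by (simp add: TL_def tensor_vecs xi_vecs eta_vecs)

lemma idem_vacuum: "0 \<le> int p + m \<Longrightarrow> act (TL m p) (idem m) (tensor xi eta) = tensor xi eta"
  unfolding act_simps(6)[OF weight_module_TL vacuum_vecs]
  by (auto simp: fun_eq_iff wt_TL tensor_def xi_def eta_def)

lemma act_mult_idem_vacuum:
  "0 \<le> int p + m \<Longrightarrow> act (TL m p) (u * idem m) (tensor xi eta) = act (TL m p) u (tensor xi eta)"
  by (simp add: act_simps(10)[OF weight_module_TL vacuum_vecs] idem_vacuum)


text \<open>
  From left to right, every element that \<open>o(1)\<close> allows has some limit, and its coefficient tends to
  zero.  From right to left, a sequence with limit zero is already a combination of the vectors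
  \<open>v\<^sub>k\<^sub>,\<^sub>l\<close> with small coefficients.
\<close>

lemma asymp_zero_iff_has_lim_zero: "asymp_zero m z \<longleftrightarrow> has_lim m z (\<lambda>k l. 0)"
proof
  assume "asymp_zero m z"
  then obtain S T c d where ST: "finite S" "S \<subseteq> Udot" "finite T" "T \<subseteq> Uplus \<times> Uminus"
    "\<forall>u\<in>S. small_coeff (c u)" "\<forall>t\<in>T. small_coeff (d t)"
    and z: "\<forall>p. 0 \<le> int p + m \<longrightarrow> (\<forall>i. z p i =
                (\<Sum>u\<in>S. c u p * act (TL m p) (u * idem m) (tensor xi eta) i)
                + (\<Sum>(x, y)\<in>T. d (x, y) p
                     * tensor (act (omega_L p) x xi) (act (L (nat (int p + m))) y eta) i))"
    unfolding asymp_zero_def by (elim exE conjE) (rule that)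
  have 1: "has_lim m (\<lambda>p i. c u p * act (TL m p) (u * idem m) (tensor xi eta) i) (\<lambda>k l. 0)"
    if "u \<in> S" for u
  proof -
    obtain \<delta> where "has_lim m (\<lambda>p. act (TL m p) (u * idem m) (tensor xi eta)) \<delta>"
      using has_lim_act[OF has_lim_vacuum] by blast
    from has_lim_mult[OF _ this, of "c u" 0] show ?thesis
      using ST(5) that by (simp add: small_coeff_iff_tends)
  qed
  have 2: "has_lim m (\<lambda>p i. d t p * pure_tensor m (fst t) (snd t) p i) (\<lambda>k l. 0)" if t: "t \<in> T" for t
  proof -
    have "fst t \<in> Uplus" "snd t \<in> Uminus"
      using ST(4) t by (auto simp: mem_Times_iff)
    then obtain \<delta> where "has_lim m (pure_tensor m (fst t) (snd t)) \<delta>"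
      using has_lim_pure_tensor by blast
    from has_lim_mult[OF _ this, of "d t" 0] show ?thesis
      using ST(6) t by (simp add: small_coeff_iff_tends)
  qed
  have "has_lim m (\<lambda>p i. (\<Sum>u\<in>S. c u p * act (TL m p) (u * idem m) (tensor xi eta) i)
      + (\<Sum>t\<in>T. d t p * pure_tensor m (fst t) (snd t) p i)) (\<lambda>k l. (\<Sum>u\<in>S. 0) + (\<Sum>t\<in>T. 0))"
    by (intro has_lim_add has_lim_sum ST 1 2)
  then have lim: "has_lim m (\<lambda>p i. (\<Sum>u\<in>S. c u p * act (TL m p) (u * idem m) (tensor xi eta) i)
      + (\<Sum>t\<in>T. d t p * pure_tensor m (fst t) (snd t) p i)) (\<lambda>k l. 0)" by simp
  show "has_lim m z (\<lambda>k l. 0)"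
    by (rule has_lim_cong[OF lim]) (use z in \<open>simp add: fun_eq_iff pure_tensor_def case_prod_unfold\<close>)
next
  assume "has_lim m z (\<lambda>k l. 0)"
  then obtain d N where d: "\<And>k l. tends (d k l) 0" "\<And>k l. N < k + l \<Longrightarrow> d k l = (\<lambda>_. 0)"
    "\<And>p k l. 0 \<le> int p + m \<Longrightarrow> z p (k, l) = (if k \<le> p \<and> int l \<le> int p + m then d k l p else 0)"
    by (rule has_limE) blast
  \<comment> \<open>The coefficients have to be indexed by the pairs \<open>(E\<^sup>(\<^sup>k\<^sup>), F\<^sup>(\<^sup>l\<^sup>))\<close> themselves, hence the inverse of \<open>f\<close>.\<close>
  define B where "B = {(k, l). k + l \<le> N}"
  define f where "f = (\<lambda>(k, l). (Ediv k, Fdiv l))"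
  define d' where "d' t = case_prod d (inv f t)" for t
  have "finite B"
    by (rule finite_subset[of _ "{..N} \<times> {..N}"]) (auto simp: B_def)
  have inj: "inj f"
    using E.inj_dpow F.inj_dpow by (auto simp: f_def Ediv_eq_dpow Fdiv_eq_dpow inj_def)
  have "z p i = (\<Sum>(x, y)\<in>f ` B. d' (x, y) p
       * tensor (act (omega_L p) x xi) (act (L (nat (int p + m))) y eta) i)"
    if p: "0 \<le> int p + m" for p i
  proof -
    obtain k l where i: "i = (k, l)" by force
    have "(\<Sum>(x, y)\<in>f ` B. d' (x, y) p
        * tensor (act (omega_L p) x xi) (act (L (nat (int p + m))) y eta) i)
      = (\<Sum>t\<in>f ` B. d' t p * pure_tensor m (fst t) (snd t) p i)"
      by (simp add: pure_tensor_def case_prod_unfold)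
    also have "\<dots> = (\<Sum>j\<in>B. d (fst j) (snd j) p * pure_tensor m (Ediv (fst j)) (Fdiv (snd j)) p i)"
      by (subst sum.reindex[OF inj_on_subset[OF inj]])
        (simp_all add: d'_def inv_f_f[OF inj], simp add: f_def case_prod_unfold)
    also have "\<dots> = (\<Sum>j\<in>B. if j = i then z p i else 0)"
      by (intro sum.cong) (auto simp: i pure_tensor_divided_powers[OF p] d(3)[OF p] unit_at_def)
    also have "\<dots> = z p i"
      using \<open>finite B\<close> by (auto simp: i d(3)[OF p] d(2) B_def)
    finally show ?thesis ..
  qed
  then show "asymp_zero m z"
    unfolding asymp_zero_def
    by (intro exI[of _ "{}"] exI[of _ "f ` B"] exI[of _ "\<lambda>_ _. 0"] exI[of _ d'])
      (use \<open>finite B\<close> d(1) in \<open>auto simp: f_def d'_def case_prod_unfold Uplus_def Uminus_def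
        Ediv_eq_dpow Fdiv_eq_dpow dpow_in_subalg small_coeff_iff_tends\<close>)
qed

definition vacuum_lim :: "int \<Rightarrow> uhat \<Rightarrow> (nat \<Rightarrow> nat \<Rightarrow> qf) \<Rightarrow> bool" where
  "vacuum_lim m u \<gamma> \<longleftrightarrow> has_lim m (\<lambda>p. act (TL m p) u (tensor xi eta)) \<gamma>"

lemma is_w_iff:
  "is_w m a b w \<longleftrightarrow> w \<in> Udot_idem m \<and> vacuum_lim m w (\<lambda>k l. unit_at a k * unit_at b l)"
proof -
  let ?\<delta> = "\<lambda>k l. unit_at a k * unit_at b l"
  have "has_lim m (\<lambda>p i. z p i - pure_tensor m (Ediv a) (Fdiv b) p i) (\<lambda>k l. 0) \<longleftrightarrow> has_lim m z ?\<delta>" for z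
  proof
    assume "has_lim m z ?\<delta>"
    from has_lim_add_mult[OF tends_const[of "- 1"] has_lim_pure_tensor_divided_powers[of m a b] this]
    show "has_lim m (\<lambda>p i. z p i - pure_tensor m (Ediv a) (Fdiv b) p i) (\<lambda>k l. 0)" by simp
  next
    assume "has_lim m (\<lambda>p i. z p i - pure_tensor m (Ediv a) (Fdiv b) p i) (\<lambda>k l. 0)"
    from has_lim_add[OF this has_lim_pure_tensor_divided_powers[of m a b]] show "has_lim m z ?\<delta>" by simp
  qed
  then show ?thesis
    unfolding is_w_def asymp_zero_iff_has_lim_zero vacuum_lim_def pure_tensor_def by simp
qed



section \<open>A recursion in an arbitrary pair of elements\<close>

text \<open>
  The parameter \<open>d\<close> stands for \<open>a - b + m\<close> in the first sum of the theorem (with \<open>X = E\<close>, \<open>Y = F\<close>) and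
  for \<open>b - a - m\<close> in the second one (with \<open>X = F\<close>, \<open>Y = E\<close> and \<open>a\<close>, \<open>b\<close> exchanged).
\<close>

definition w_coeff :: "int \<Rightarrow> nat \<Rightarrow> qf" where
  "w_coeff d s = (- 1) ^ s * q powi (- int s + int s * d) / qpoch s"

definition w_sum :: "uhat \<Rightarrow> uhat \<Rightarrow> int \<Rightarrow> nat \<Rightarrow> nat \<Rightarrow> uhat" where
  "w_sum X Y d a b = (\<Sum>s=0..min a b. scal (w_coeff d s) * (dpow X (a - s) * dpow Y (b - s)))"

text \<open>
  After cancelling the common factors this is
  \<open>q\<^sup>-\<^sup>s\<^sup>-\<^sup>1 [a - s] = [a + 1] - q\<^sup>a\<^sup>+\<^sup>1 (1 - q\<^sup>-\<^sup>2\<^sup>s\<^sup>-\<^sup>2)/(q - q\<^sup>-\<^sup>1)\<close>, which is \<open>key\<close> below.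
\<close>

lemma w_coeff_Suc:
  "w_coeff d (Suc s) * qint (int a - int s)
     = qint (int a + 1) * w_coeff (d + 1) (Suc s)
       + q powi (int a + 1 + d) / (q - q powi (- 1)) * w_coeff (d + 1) s"
proof -
  define e where "e = q - q powi (- 1)"
  define r where "r = 1 - q powi (- 2 * int (Suc s))"
  define u where "u = q powi (int s * d)"
  define V where "V = q powi (- 1 - int s)"
  define x where "x = q powi (int a - int s) - q powi (- (int a - int s))"
  define y where "y = q powi (int a + 1) - q powi (- (int a + 1))"
  have nz: "e \<noteq> 0" "r \<noteq> 0" "qpoch s \<noteq> 0"
    using q_sq_ne_1 q_powi_ne_1[of "- 2 * int (Suc s)"] qpoch_nonzero by (simp_all add: e_def r_def)
  have key: "V * x = y - q powi (int a + 1) * r"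
    unfolding V_def x_def y_def r_def right_diff_distrib q_powi_add[symmetric]
    by (simp add: algebra_simps)
  have exps: "- int (Suc s) + int (Suc s) * d = int s * d + d + (- 1 - int s)"
    "- int (Suc s) + int (Suc s) * (d + 1) = int s * d + d" "- int s + int s * (d + 1) = int s * d"
    by (simp_all add: algebra_simps)
  have 1: "w_coeff d (Suc s) = - ((- 1) ^ s * u * q powi d * V / (qpoch s * r))"
    unfolding w_coeff_def exps q_powi_add by (simp add: qpoch_Suc r_def u_def V_def)
  have 2: "w_coeff (d + 1) (Suc s) = - ((- 1) ^ s * u * q powi d / (qpoch s * r))"
    unfolding w_coeff_def exps q_powi_add by (simp add: qpoch_Suc r_def u_def)
  have 3: "w_coeff (d + 1) s = (- 1) ^ s * u / qpoch s"
    unfolding w_coeff_def exps by (simp add: u_def)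
  have 4: "qint (int a - int s) = x / e" "qint (int a + 1) = y / e"
    by (simp_all add: qint_def x_def y_def e_def)
  have "w_coeff d (Suc s) * qint (int a - int s) = - ((- 1) ^ s * u * q powi d * (V * x) / (qpoch s * r * e))"
    unfolding 1 4 by simp
  also have "\<dots> = y / e * w_coeff (d + 1) (Suc s) + q powi (int a + 1) * q powi d / e * w_coeff (d + 1) s"
    unfolding key 2 3 using nz by (simp add: field_simps)
  finally show ?thesis
    unfolding 4 q_powi_add[of "int a + 1" d] e_def .
qed

text \<open>
  A summation range independent of \<open>min a b\<close>, so that sums for different \<open>a\<close> and \<open>b\<close> can be compared
  termwise.
\<close>

lemma w_sum_eq_sum_atMost:
  assumes "min a b \<le> B"
  shows "w_sum X Y d a b = (\<Sum>s\<le>B. scal (w_coeff d s) *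
    (if s \<le> a \<and> s \<le> b then dpow X (a - s) * dpow Y (b - s) else 0))"
  unfolding w_sum_def using assms
  by (intro sum.mono_neutral_cong_left) auto

text \<open>
  Both \<open>w_sum\<close> on the right have the same value of \<open>d\<close>, since \<open>a + 1 - b = a - (b - 1)\<close>, and their
  monomials are those of \<open>X * w_sum X Y d a b\<close>.  So the identity reduces to comparing the coefficients
  of \<open>X\<^sup>(\<^sup>a\<^sup>+\<^sup>1\<^sup>-\<^sup>s\<^sup>) Y\<^sup>(\<^sup>b\<^sup>-\<^sup>s\<^sup>)\<close>, as in a free algebra.
\<close>

lemma mult_w_sum:
  "X * w_sum X Y d a b = scal (qint (int a + 1)) * w_sum X Y (d + 1) (Suc a) b
     + (if b = 0 then 0
        else scal (q powi (int a + 1 + d) / (q - q powi (- 1))) * w_sum X Y (d + 1) a (b - 1))"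
proof -
  define c where "c = q powi (int a + 1 + d) / (q - q powi (- 1))"
  define T where "T s = (if s \<le> Suc a \<and> s \<le> b then dpow X (Suc a - s) * dpow Y (b - s) else 0)" for s
  let ?B = "Suc (a + b)"
  have "X * w_sum X Y d a b = (\<Sum>s\<le>?B. X * (scal (w_coeff d s) *
      (if s \<le> a \<and> s \<le> b then dpow X (a - s) * dpow Y (b - s) else 0)))"
    by (subst w_sum_eq_sum_atMost[of a b ?B]) (simp, simp only: sum_distrib_left)
  also have "\<dots> = (\<Sum>s\<le>?B. scal (w_coeff d s * qint (int a + 1 - int s)) * T s)"
  proof (rule sum.cong)
    fix s
    have "X * (if s \<le> a \<and> s \<le> b then dpow X (a - s) * dpow Y (b - s) else 0)
        = scal (qint (int a + 1 - int s)) * T s"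
    proof (cases "s \<le> a")
      case True
      then have "Suc a - s = Suc (a - s)" "int a + 1 - int s = 1 + int (a - s)" by auto
      then have "X * dpow X (a - s) = scal (qint (int a + 1 - int s)) * dpow X (Suc a - s)"
        by (simp only: mult_dpow)
      then show ?thesis using True by (simp add: T_def flip: mult.assoc)
    next
      case False
      then show ?thesis by (cases "s = Suc a") (auto simp: T_def)
    qed
    then show "X * (scal (w_coeff d s) * (if s \<le> a \<and> s \<le> b then dpow X (a - s) * dpow Y (b - s) else 0))
        = scal (w_coeff d s * qint (int a + 1 - int s)) * T s"
      by (simp only: scal_left_commute[of X] scal_mult mult.assoc)
  qed simp
  also have "\<dots> = scal (w_coeff d 0 * qint (int a + 1)) * T 0
      + (\<Sum>s\<le>a + b. scal (w_coeff d (Suc s) * qint (int a - int s)) * T (Suc s))"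
    by (subst sum.atMost_Suc_shift) simp
  also have "\<dots> = scal (qint (int a + 1) * w_coeff (d + 1) 0) * T 0
      + (\<Sum>s\<le>a + b. scal (qint (int a + 1) * w_coeff (d + 1) (Suc s)) * T (Suc s))
      + (\<Sum>s\<le>a + b. scal (c * w_coeff (d + 1) s) * T (Suc s))"
  proof -
    have "w_coeff d 0 * qint (int a + 1) = qint (int a + 1) * w_coeff (d + 1) 0"
      by (simp add: w_coeff_def)
    then show ?thesis
      unfolding w_coeff_Suc c_def[symmetric]
      by (simp only: scal_add distrib_right sum.distrib add.assoc)
  qed
  also have "scal (qint (int a + 1) * w_coeff (d + 1) 0) * T 0
      + (\<Sum>s\<le>a + b. scal (qint (int a + 1) * w_coeff (d + 1) (Suc s)) * T (Suc s))
      = scal (qint (int a + 1)) * w_sum X Y (d + 1) (Suc a) b"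
    by (subst w_sum_eq_sum_atMost[of "Suc a" b ?B], simp)
      (simp only: sum_distrib_left scal_mult mult.assoc T_def[symmetric] sum.atMost_Suc_shift distrib_left)
  also have "(\<Sum>s\<le>a + b. scal (c * w_coeff (d + 1) s) * T (Suc s))
      = (if b = 0 then 0 else scal c * w_sum X Y (d + 1) a (b - 1))"
  proof (cases b)
    case 0
    then show ?thesis by (simp add: T_def)
  next
    case (Suc b')
    have "w_sum X Y (d + 1) a b' = (\<Sum>s\<le>a + b. scal (w_coeff (d + 1) s) * T (Suc s))"
      by (subst w_sum_eq_sum_atMost[of a b' "a + b"], simp add: Suc) (simp add: T_def Suc cong: if_cong)
    then show ?thesis by (simp add: Suc sum_distrib_left distrib_left scal_mult mult.assoc)
  qed
  finally show ?thesis unfolding c_def .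
qed

section \<open>Limits of the two families\<close>

lemma vacuum_lim_add:
  "vacuum_lim m u \<gamma> \<Longrightarrow> vacuum_lim m v \<delta> \<Longrightarrow> vacuum_lim m (u + v) (\<lambda>k l. \<gamma> k l + \<delta> k l)"
  unfolding vacuum_lim_def act_simps(9)[OF weight_module_TL vacuum_vecs] by (rule has_lim_add)

lemma vacuum_lim_scal: "vacuum_lim m u \<gamma> \<Longrightarrow> vacuum_lim m (scal c * u) (\<lambda>k l. c * \<gamma> k l)"
  unfolding vacuum_lim_def act_simps(10)[OF weight_module_TL vacuum_vecs]
    act_simps(1)[OF weight_module_TL act_vecs[OF vacuum_vecs]]
  by (rule has_lim_mult[OF tends_const])

lemma vacuum_lim_E:
  "vacuum_lim m u \<gamma> \<Longrightarrow> vacuum_lim m (gE * u) (\<lambda>k l. qint (int k) * \<gamma> (k - 1) l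
    + q powi (2 * int k + (m - int l)) / (q - q powi (- 1)) * \<gamma> k (Suc l))"
  unfolding vacuum_lim_def act_simps(10)[OF weight_module_TL vacuum_vecs] by (rule has_lim_E)

lemma vacuum_lim_F:
  "vacuum_lim m u \<gamma> \<Longrightarrow> vacuum_lim m (gF * u) (\<lambda>k l. qint (int l) * \<gamma> k (l - 1)
    + q powi (2 * int l - m + - int k) / (q - q powi (- 1)) * \<gamma> (Suc k) l)"
  unfolding vacuum_lim_def act_simps(10)[OF weight_module_TL vacuum_vecs] by (rule has_lim_F)

lemma vacuum_lim_one: "vacuum_lim m 1 (\<lambda>k l. unit_at 0 k * unit_at 0 l)"
  unfolding vacuum_lim_def act_simps(8)[OF weight_module_TL vacuum_vecs] by (rule has_lim_vacuum)

lemma vacuum_lim_idem: "vacuum_lim m (u * idem m) \<gamma> \<longleftrightarrow> vacuum_lim m u \<gamma>"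
  unfolding vacuum_lim_def by (auto elim!: has_lim_cong simp: act_mult_idem_vacuum)

lemma vacuum_lim_unique: "vacuum_lim m u \<gamma> \<Longrightarrow> vacuum_lim m u \<delta> \<Longrightarrow> \<gamma> = \<delta>"
  unfolding vacuum_lim_def by (rule has_lim_unique)

lemma vacuum_lim_dpow_F: "vacuum_lim m (dpow gF b) (\<lambda>k l. unit_at 0 k * unit_at b l)"
proof (induction b)
  case 0
  show ?case using vacuum_lim_one by simp
next
  case (Suc b)
  have "1 / qint (1 + int b) * (qint (int l) * (unit_at 0 k * unit_at b (l - 1))
      + q powi (2 * int l - m + - int k) / (q - q powi (- 1)) * (unit_at 0 (Suc k) * unit_at b l))
    = unit_at 0 k * unit_at (Suc b) l" for k l
    using qint_nonzero[of "1 + int b"] by (cases l) (auto simp: unit_at_def)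
  with vacuum_lim_scal[OF vacuum_lim_F[OF Suc], of "1 / qint (1 + int b)"] show ?case
    by (simp only: dpow_Suc)
qed

lemma vacuum_lim_dpow_E: "vacuum_lim m (dpow gE a) (\<lambda>k l. unit_at a k * unit_at 0 l)"
proof (induction a)
  case 0
  show ?case using vacuum_lim_one by simp
next
  case (Suc a)
  have "1 / qint (1 + int a) * (qint (int k) * (unit_at a (k - 1) * unit_at 0 l)
      + q powi (2 * int k + (m - int l)) / (q - q powi (- 1)) * (unit_at a k * unit_at 0 (Suc l)))
    = unit_at (Suc a) k * unit_at 0 l" for k l
    using qint_nonzero[of "1 + int a"] by (cases k) (auto simp: unit_at_def)
  with vacuum_lim_scal[OF vacuum_lim_E[OF Suc], of "1 / qint (1 + int a)"] show ?case
    by (simp only: dpow_Suc)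
qed

text \<open>
  The recursion solved for its leading term.  For \<open>b = 0\<close> the last summand is switched off by a zero
  scalar, so that a single shape covers all cases of the inductions below.
\<close>

lemma w_sum_Suc:
  "w_sum X Y (d + 1) (Suc a) b = scal (1 / qint (1 + int a)) * (X * w_sum X Y d a b
     + scal (- (if b = 0 then 0 else q powi (int a + 1 + d) / (q - q powi (- 1)))) * w_sum X Y (d + 1) a (b - 1))"
proof -
  have "X * w_sum X Y d a b
     + scal (- (if b = 0 then 0 else q powi (int a + 1 + d) / (q - q powi (- 1)))) * w_sum X Y (d + 1) a (b - 1)
     = scal (qint (1 + int a)) * w_sum X Y (d + 1) (Suc a) b"
    by (simp add: mult_w_sum scal_uminus add.commute)
  then show ?thesis
    using qint_nonzero[of "1 + int a"] by (simp add: mult.assoc[symmetric] flip: scal_mult)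
qed

lemma w_sum_0: "w_sum X Y d 0 b = dpow Y b"
  by (simp add: w_sum_def w_coeff_def qpoch_def)

text \<open>
  The recursion has the coefficients with which \<open>E\<close> acts on limits: for \<open>d = a - b + m\<close> the factor
  \<open>q\<^sup>a\<^sup>+\<^sup>1\<^sup>+\<^sup>d\<close> is the coefficient \<open>q\<^sup>2\<^sup>a\<^sup>+\<^sup>m\<^sup>-\<^sup>b\<^sup>+\<^sup>1\<close> of \<open>v\<^sub>a\<^sub>,\<^sub>b\<^sub>-\<^sub>1\<close> in \<open>E v\<^sub>a\<^sub>,\<^sub>b\<close> at \<open>t = 0\<close>.  Hence
  \<open>[a + 1] w_sum (a + 1) b\<close> has limit \<open>[a + 1] v\<^sub>a\<^sub>+\<^sub>1\<^sub>,\<^sub>b\<close>.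
\<close>

lemma vacuum_lim_w_sum_EF:
  "vacuum_lim m (w_sum gE gF (int a - int b + m) a b) (\<lambda>k l. unit_at a k * unit_at b l)"
proof (induction a arbitrary: b)
  case 0
  show ?case by (simp add: w_sum_0 vacuum_lim_dpow_F)
next
  case (Suc a)
  let ?d = "int a - int b + m"
  define c where "c = - (if b = 0 then 0 else q powi (int a + 1 + ?d) / (q - q powi (- 1)))"
  have lim: "vacuum_lim m (scal c * w_sum gE gF (?d + 1) a (b - 1))
      (\<lambda>k l. c * (unit_at a k * unit_at (b - 1) l))"
  proof (cases "b = 0")
    case True
    then show ?thesis using vacuum_lim_scal[OF vacuum_lim_one, of m 0] by (simp add: c_def)
  next
    case False
    then have "int a - int (b - 1) + m = ?d + 1" by simp
    with vacuum_lim_scal[OF Suc[of "b - 1"], of c] show ?thesis by (simp only:)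
  qed
  have "1 / qint (1 + int a) * (qint (int k) * (unit_at a (k - 1) * unit_at b l)
      + q powi (2 * int k + (m - int l)) / (q - q powi (- 1)) * (unit_at a k * unit_at b (Suc l))
      + c * (unit_at a k * unit_at (b - 1) l)) = unit_at (Suc a) k * unit_at b l" for k l
  proof -
    have "q powi (2 * int k + (m - int l)) / (q - q powi (- 1)) * (unit_at a k * unit_at b (Suc l))
      + c * (unit_at a k * unit_at (b - 1) l) = 0"
      by (cases b) (auto simp: unit_at_def c_def algebra_simps)
    moreover have "qint (int k) * (unit_at a (k - 1) * unit_at b l)
        = qint (1 + int a) * (unit_at (Suc a) k * unit_at b l)"
      by (cases k) (auto simp: unit_at_def)
    ultimately show ?thesis
      using qint_nonzero[of "1 + int a"] by (simp only: add.assoc) simp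
  qed
  with vacuum_lim_scal[OF vacuum_lim_add[OF vacuum_lim_E[OF Suc[of b]] lim], of "1 / qint (1 + int a)"]
  have "vacuum_lim m (w_sum gE gF (?d + 1) (Suc a) b) (\<lambda>k l. unit_at (Suc a) k * unit_at b l)"
    by (simp only: w_sum_Suc c_def)
  then show ?case by (simp add: algebra_simps)
qed

text \<open>
  The mirror image under exchanging \<open>E\<close> with \<open>F\<close>, \<open>a\<close> with \<open>b\<close> and \<open>m\<close> with \<open>-m\<close>.
\<close>

lemma vacuum_lim_w_sum_FE:
  "vacuum_lim m (w_sum gF gE (int b - int a - m) b a) (\<lambda>k l. unit_at a k * unit_at b l)"
proof (induction b arbitrary: a)
  case 0
  show ?case by (simp add: w_sum_0 vacuum_lim_dpow_E)
next
  case (Suc b)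
  let ?d = "int b - int a - m"
  define c where "c = - (if a = 0 then 0 else q powi (int b + 1 + ?d) / (q - q powi (- 1)))"
  have lim: "vacuum_lim m (scal c * w_sum gF gE (?d + 1) b (a - 1))
      (\<lambda>k l. c * (unit_at (a - 1) k * unit_at b l))"
  proof (cases "a = 0")
    case True
    then show ?thesis using vacuum_lim_scal[OF vacuum_lim_one, of m 0] by (simp add: c_def)
  next
    case False
    then have "int b - int (a - 1) - m = ?d + 1" by simp
    with vacuum_lim_scal[OF Suc[of "a - 1"], of c] show ?thesis by (simp only:)
  qed
  have "1 / qint (1 + int b) * (qint (int l) * (unit_at a k * unit_at b (l - 1))
      + q powi (2 * int l - m + - int k) / (q - q powi (- 1)) * (unit_at a (Suc k) * unit_at b l)
      + c * (unit_at (a - 1) k * unit_at b l)) = unit_at a k * unit_at (Suc b) l" for k l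
  proof -
    have "q powi (2 * int l - m + - int k) / (q - q powi (- 1)) * (unit_at a (Suc k) * unit_at b l)
      + c * (unit_at (a - 1) k * unit_at b l) = 0"
      by (cases a) (auto simp: unit_at_def c_def algebra_simps)
    moreover have "qint (int l) * (unit_at a k * unit_at b (l - 1))
        = qint (1 + int b) * (unit_at a k * unit_at (Suc b) l)"
      by (cases l) (auto simp: unit_at_def)
    ultimately show ?thesis
      using qint_nonzero[of "1 + int b"] by (simp only: add.assoc) simp
  qed
  with vacuum_lim_scal[OF vacuum_lim_add[OF vacuum_lim_F[OF Suc[of a]] lim], of "1 / qint (1 + int b)"]
  have "vacuum_lim m (w_sum gF gE (?d + 1) (Suc b) a) (\<lambda>k l. unit_at a k * unit_at (Suc b) l)"
    by (simp only: w_sum_Suc c_def)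
  then show ?case by (simp add: algebra_simps)
qed

section \<open>Spanning and uniqueness\<close>

interpretation uhat: vector_space "\<lambda>c x. scal c * x"
  by unfold_locales (simp_all add: distrib_left distrib_right scal_add scal_mult mult.assoc)

definition pbw :: "int \<Rightarrow> nat \<Rightarrow> nat \<Rightarrow> uhat" where
  "pbw m i j = gE ^ i * (gF ^ j * idem m)"

definition pbw_span :: "int \<Rightarrow> uhat set" where
  "pbw_span m = uhat.span (range (case_prod (pbw m)))"

lemma pbw_in_span: "pbw m i j \<in> pbw_span m"
  unfolding pbw_span_def by (rule uhat.span_base) (auto intro: image_eqI[of _ _ "(i, j)"])

lemma left_mult_span:
  assumes "\<And>v. v \<in> A \<Longrightarrow> x * v \<in> uhat.span B" and "v \<in> uhat.span A"
  shows "x * v \<in> uhat.span B"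
  using assms(2)
proof (induction rule: uhat.span_induct_alt)
  case base
  show ?case by (simp add: uhat.span_zero)
next
  case (step c v w)
  then show ?case
    by (simp add: distrib_left scal_left_commute[of x] assms(1) uhat.span_add uhat.span_scale)
qed

lemma left_mult_pbw_span:
  assumes "\<And>i j. x * pbw m i j \<in> pbw_span m" "v \<in> pbw_span m"
  shows "x * v \<in> pbw_span m"
  unfolding pbw_span_def
  by (rule left_mult_span[OF _ assms(2)[unfolded pbw_span_def]])
    (use assms(1) in \<open>auto simp: pbw_span_def\<close>)

lemma pbw_weight: "pbw m i j = idem (m + 2 * int i - 2 * int j) * pbw m i j"
proof -
  have F: "gF ^ j * idem m = idem (m - 2 * int j) * gF ^ j"
  proof (induction j)
    case (Suc j)
    have "gF ^ Suc j * idem m = gF * idem (m - 2 * int j) * gF ^ j"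
      by (simp only: power_Suc mult.assoc Suc)
    also have "\<dots> = idem (m - 2 * int j - 2) * gF ^ Suc j"
      by (simp only: gF_idem power_Suc mult.assoc)
    also have "m - 2 * int j - 2 = m - 2 * int (Suc j)" by simp
    finally show ?case .
  qed simp
  have E: "gE ^ i * idem n = idem (n + 2 * int i) * gE ^ i" for n
  proof (induction i)
    case (Suc i)
    have "gE ^ Suc i * idem n = gE * idem (n + 2 * int i) * gE ^ i"
      by (simp only: power_Suc mult.assoc Suc)
    also have "\<dots> = idem (n + 2 * int i + 2) * gE ^ Suc i"
      by (simp only: gE_idem power_Suc mult.assoc)
    also have "n + 2 * int i + 2 = n + 2 * int (Suc i)" by simp
    finally show ?case .
  qed simp
  have "pbw m i j = idem (m - 2 * int j + 2 * int i) * (gE ^ i * gF ^ j)"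
    unfolding pbw_def F by (simp only: mult.assoc[symmetric] E)
  also have "m - 2 * int j + 2 * int i = m + 2 * int i - 2 * int j" by simp
  finally have eq: "pbw m i j = idem (m + 2 * int i - 2 * int j) * (gE ^ i * gF ^ j)" .
  show ?thesis
    unfolding eq mult.assoc[symmetric] idem_idem by simp
qed

lemma gKi_idem: "gKi * idem n = scal (q powi (- n)) * idem n"
proof -
  have "scal (q powi n) * (gKi * idem n) = gKi * (gK * idem n)"
    by (simp only: gK_idem scal_left_commute[of gKi])
  also have "\<dots> = idem n" by (simp add: mult.assoc[symmetric] gKi_gK)
  finally have "scal (q powi n) * (gKi * idem n) = idem n" .
  then have "scal (q powi (- n)) * (scal (q powi n) * (gKi * idem n)) = scal (q powi (- n)) * idem n"
    by simp
  then show ?thesis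
    by (simp add: mult.assoc[symmetric] flip: scal_mult q_powi_add)
qed

text \<open>
  Closure under \<open>K\<^sup>\<plusminus>\<^sup>1\<close> and the idempotents holds because the monomials are weight vectors.  The case
  of \<open>F\<close> is by induction on the exponent of \<open>E\<close>, using \<open>F E = E F - (K - K\<^sup>-\<^sup>1)/(q - q\<^sup>-\<^sup>1)\<close>.
\<close>

lemma pbw_span_left_ideal: "v \<in> pbw_span m \<Longrightarrow> x * v \<in> pbw_span m"
proof (induction x arbitrary: v rule: uhat_induct)
  case (scal c)
  then show ?case by (simp add: pbw_span_def uhat.span_scale)
next
  case gE
  have "gE * pbw m i j = pbw m (Suc i) j" for i j by (simp add: pbw_def mult.assoc)
  then show ?case by (intro left_mult_pbw_span[OF _ gE]) (simp add: pbw_in_span)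
next
  case gK
  have "gK * pbw m i j = scal (q powi (m + 2 * int i - 2 * int j)) * pbw m i j" for i j
    by (subst (1 2) pbw_weight) (simp add: mult.assoc[symmetric] gK_idem)
  then show ?case
    by (intro left_mult_pbw_span[OF _ gK]) (simp add: pbw_in_span[unfolded pbw_span_def] pbw_span_def uhat.span_scale)
next
  case gKi
  have "gKi * pbw m i j = scal (q powi (- (m + 2 * int i - 2 * int j))) * pbw m i j" for i j
    by (subst (1 2) pbw_weight) (simp add: mult.assoc[symmetric] gKi_idem)
  then show ?case
    by (intro left_mult_pbw_span[OF _ gKi]) (simp add: pbw_in_span[unfolded pbw_span_def] pbw_span_def uhat.span_scale)
next
  case (idem n)
  have "idem n * pbw m i j = (if n = m + 2 * int i - 2 * int j then pbw m i j else 0)" for i j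
    by (subst (1 2) pbw_weight) (simp add: mult.assoc[symmetric] idem_idem)
  then show ?case
    by (intro left_mult_pbw_span[OF _ idem]) (simp add: pbw_in_span[unfolded pbw_span_def] pbw_span_def uhat.span_zero)
next
  case gF
  show ?case
  proof (rule left_mult_pbw_span[OF _ gF])
    fix i j
    show "gF * pbw m i j \<in> pbw_span m"
    proof (induction i)
      case 0
      have "gF * pbw m 0 j = pbw m 0 (Suc j)" by (simp add: pbw_def mult.assoc)
      then show ?case by (simp add: pbw_in_span)
    next
      case (Suc i)
      let ?w = "m + 2 * int i - 2 * int j"
      let ?e = "scal (1 / (q - q powi (- 1)))"
      have "gF * pbw m (Suc i) j = gF * gE * pbw m i j" by (simp add: pbw_def mult.assoc)
      also have "gF * gE = gE * gF - ?e * (gK - gKi)"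
        using gE_gF by (simp add: algebra_simps)
      also have "(gE * gF - ?e * (gK - gKi)) * pbw m i j
          = gE * (gF * pbw m i j) - ?e * (gK * pbw m i j - gKi * pbw m i j)"
        by (simp only: left_diff_distrib right_diff_distrib mult.assoc)
      also have "gK * pbw m i j - gKi * pbw m i j = scal (q powi ?w) * pbw m i j - scal (q powi (- ?w)) * pbw m i j"
        by (subst (1 2 3 4) pbw_weight) (simp only: mult.assoc[symmetric] gK_idem gKi_idem)
      finally have eq: "gF * pbw m (Suc i) j = gE * (gF * pbw m i j)
          - ?e * (scal (q powi ?w) * pbw m i j - scal (q powi (- ?w)) * pbw m i j)" .
      have "gE * pbw m i j = pbw m (Suc i) j" for i j by (simp add: pbw_def mult.assoc)
      then have "gE * (gF * pbw m i j) \<in> pbw_span m"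
        by (intro left_mult_pbw_span[OF _ Suc]) (simp add: pbw_in_span)
      then show ?case
        unfolding eq pbw_span_def
        by (intro uhat.span_diff uhat.span_scale pbw_in_span[unfolded pbw_span_def])
    qed
  qed
next
  case (add x y)
  then show ?case by (simp add: distrib_right pbw_span_def uhat.span_add)
next
  case (mult x y)
  then show ?case by (simp add: mult.assoc)
qed

definition w_EF :: "int \<Rightarrow> nat \<Rightarrow> nat \<Rightarrow> uhat" where
  "w_EF m a b = w_sum gE gF (int a - int b + m) a b * idem m"

lemma vacuum_lim_w_EF: "vacuum_lim m (w_EF m a b) (\<lambda>k l. unit_at a k * unit_at b l)"
  by (simp add: w_EF_def vacuum_lim_idem vacuum_lim_w_sum_EF)

lemma w_EF_in_span: "w_EF m a b \<in> uhat.span (range (case_prod (w_EF m)))"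
  by (rule uhat.span_base) (auto intro: image_eqI[of _ _ "(a, b)"])

text \<open>
  The recursion once more, now read as stability of the span under \<open>E\<close>.
\<close>

lemma gE_w_EF: "gE * w_EF m a b \<in> uhat.span (range (case_prod (w_EF m)))"
proof -
  let ?d = "int a - int b + m"
  have eq: "gE * w_EF m a b = scal (qint (int a + 1)) * w_EF m (Suc a) b
     + (if b = 0 then 0
        else scal (q powi (int a + 1 + ?d) / (q - q powi (- 1))) * w_EF m a (b - 1))"
  proof -
    have "?d + 1 = int (Suc a) - int b + m" by simp
    then have 1: "w_EF m (Suc a) b = w_sum gE gF (?d + 1) (Suc a) b * idem m"
      by (simp only: w_EF_def)
    have 2: "w_EF m a (b - 1) = w_sum gE gF (?d + 1) a (b - 1) * idem m" if "b \<noteq> 0"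
    proof -
      from that have "?d + 1 = int a - int (b - 1) + m" by simp
      then show ?thesis by (simp only: w_EF_def)
    qed
    have "gE * w_EF m a b = (gE * w_sum gE gF ?d a b) * idem m"
      by (simp only: w_EF_def mult.assoc)
    then show ?thesis
      unfolding mult_w_sum using 1 2 by (cases "b = 0") (simp_all add: distrib_right mult.assoc)
  qed
  show ?thesis
    unfolding eq by (auto intro!: uhat.span_add uhat.span_scale w_EF_in_span simp: uhat.span_zero)
qed

text \<open>
  The family contains all \<open>F\<^sup>(\<^sup>j\<^sup>) 1\<^sub>m\<close>, and its span is stable under \<open>E\<close>.
\<close>

lemma pbw_in_span_w_EF: "pbw m i j \<in> uhat.span (range (case_prod (w_EF m)))"
proof (induction i)
  case 0
  have "pbw m 0 j = scal (qfact j) * w_EF m 0 j"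
  proof -
    have "qfact j \<noteq> 0" by (induction j) (simp_all add: qfact_Suc qint_nonzero, simp add: qfact_def)
    then show ?thesis
      by (simp add: pbw_def w_EF_def w_sum_0 dpow_def mult.assoc[symmetric] flip: scal_mult)
  qed
  then show ?case by (simp add: w_EF_in_span uhat.span_scale)
next
  case (Suc i)
  have "gE * pbw m i j \<in> uhat.span (range (case_prod (w_EF m)))"
    by (rule left_mult_span[OF _ Suc]) (auto simp: gE_w_EF)
  then show ?case by (simp add: pbw_def mult.assoc)
qed

lemma mult_idem_in_span_w_EF: "x * idem m \<in> uhat.span (range (case_prod (w_EF m)))"
proof -
  have "x * pbw m 0 0 \<in> pbw_span m" by (rule pbw_span_left_ideal[OF pbw_in_span])
  moreover have "pbw_span m \<subseteq> uhat.span (range (case_prod (w_EF m)))"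
    unfolding pbw_span_def
    by (rule uhat.span_minimal) (auto simp: pbw_in_span_w_EF uhat.subspace_span)
  ultimately show ?thesis by (auto simp: pbw_def)
qed

text \<open>
  Expand in the family \<open>w_EF\<close>: the limit is then the function whose value at the index of a member is
  the coefficient of this member, so all coefficients vanish.
\<close>

lemma vacuum_lim_zero_imp_zero:
  assumes "vacuum_lim m (x * idem m) (\<lambda>k l. 0)"
  shows "x * idem m = 0"
proof -
  obtain T r where T: "finite T" "T \<subseteq> range (case_prod (w_EF m))"
    and x: "x * idem m = (\<Sum>v\<in>T. scal (r v) * v)"
    using mult_idem_in_span_w_EF[of x m] unfolding uhat.span_explicit by auto
  \<comment> \<open>The span is that of a set of elements; \<open>g\<close> recovers one index for each of them.\<close>
  have "\<forall>v\<in>T. \<exists>i. v = w_EF m (fst i) (snd i)"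
    using T(2) by fastforce
  then obtain g where g: "\<And>v. v \<in> T \<Longrightarrow> v = w_EF m (fst (g v)) (snd (g v))" by metis
  have "vacuum_lim m (\<Sum>v\<in>S. scal (r v) * v)
      (\<lambda>k l. \<Sum>v\<in>S. r v * (unit_at (fst (g v)) k * unit_at (snd (g v)) l))" if "finite S" "S \<subseteq> T" for S
    using that
  proof (induction S)
    case empty
    show ?case using vacuum_lim_scal[OF vacuum_lim_one, of m 0] by simp
  next
    case (insert v S)
    have "vacuum_lim m v (\<lambda>k l. unit_at (fst (g v)) k * unit_at (snd (g v)) l)"
      using vacuum_lim_w_EF[of m "fst (g v)" "snd (g v)"] g[of v] insert.prems by simp
    with insert show ?case by (simp add: vacuum_lim_add vacuum_lim_scal)
  qed
  from this[OF T(1) order_refl] assms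
  have "(\<lambda>k l. \<Sum>v\<in>T. r v * (unit_at (fst (g v)) k * unit_at (snd (g v)) l)) = (\<lambda>k l. 0)"
    unfolding x by (rule vacuum_lim_unique)
  then have sum0: "(\<Sum>v\<in>T. r v * (unit_at (fst (g v)) k * unit_at (snd (g v)) l)) = 0" for k l
    by metis
  have "r w = 0" if w: "w \<in> T" for w
  proof -
    have "(\<Sum>v\<in>T. r v * (unit_at (fst (g v)) (fst (g w)) * unit_at (snd (g v)) (snd (g w))))
        = (\<Sum>v\<in>T. if v = w then r v else 0)"
    proof (rule sum.cong)
      fix v assume v: "v \<in> T"
      show "r v * (unit_at (fst (g v)) (fst (g w)) * unit_at (snd (g v)) (snd (g w)))
          = (if v = w then r v else 0)"
        using g[OF v] g[OF w] by (auto simp: unit_at_def)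
    qed simp
    then show ?thesis using sum0 T(1) w by simp
  qed
  then show ?thesis by (simp add: x)
qed

lemma mult_idem_in_Udot_idem: "x * idem m \<in> Udot_idem m"
proof -
  have "x * idem m = (x * idem m * 1) * idem m" by (simp add: mult.assoc idem_idem)
  then show ?thesis unfolding Udot_idem_def using Udot_gen[of x m 1] by blast
qed

text \<open>
  The limit alone characterises \<open>w\<^sub>m(a,b)\<close>, whatever the expression that has it.
\<close>

lemma w_elt_eq:
  assumes "vacuum_lim m x (\<lambda>k l. unit_at a k * unit_at b l)"
  shows "w_elt m a b = x * idem m"
  unfolding w_elt_def is_w_iff
proof (rule the_equality)
  show "x * idem m \<in> Udot_idem m \<and> vacuum_lim m (x * idem m) (\<lambda>k l. unit_at a k * unit_at b l)"
    using assms by (simp add: mult_idem_in_Udot_idem vacuum_lim_idem)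
next
  fix w assume w: "w \<in> Udot_idem m \<and> vacuum_lim m w (\<lambda>k l. unit_at a k * unit_at b l)"
  then obtain y where y: "w = y * idem m" by (auto simp: Udot_idem_def)
  with w have "vacuum_lim m y (\<lambda>k l. unit_at a k * unit_at b l)" by (simp add: vacuum_lim_idem)
  from vacuum_lim_add[OF vacuum_lim_scal[OF assms, of "- 1"] this]
  have "vacuum_lim m ((y - x) * idem m) (\<lambda>k l. 0)"
    by (simp add: vacuum_lim_idem scal_uminus)
  then have "(y - x) * idem m = 0" by (rule vacuum_lim_zero_imp_zero)
  then show "w = x * idem m" by (simp add: y left_diff_distrib)
qed

theorem theorem3p12:
  fixes a b :: nat and m :: int
  shows
    "(m \<le> int b - int a \<longrightarrow>
        w_elt m a b =
          (\<Sum>s=0..min a b.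
             scal ((- 1) ^ s * q powi (- int s + int s * (int a - int b + m)) / qpoch s)
               * Ediv (a - s) * Fdiv (b - s) * idem m))
     \<and> (m \<ge> int b - int a \<longrightarrow>
        w_elt m a b =
          (\<Sum>s=0..min a b.
             scal ((- 1) ^ s * q powi (- int s - int s * (int a - int b + m)) / qpoch s)
               * Fdiv (b - s) * Ediv (a - s) * idem m))"
proof (intro conjI impI)
  show "w_elt m a b =
          (\<Sum>s=0..min a b.
             scal ((- 1) ^ s * q powi (- int s + int s * (int a - int b + m)) / qpoch s)
               * Ediv (a - s) * Fdiv (b - s) * idem m)"
    unfolding w_elt_eq[OF vacuum_lim_w_sum_EF] w_sum_def w_coeff_def sum_distrib_right
    by (simp only: Ediv_eq_dpow Fdiv_eq_dpow mult.assoc)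
next
  have "- int s + int s * (int b - int a - m) = - int s - int s * (int a - int b + m)" for s
    by (simp add: algebra_simps)
  then show "w_elt m a b =
          (\<Sum>s=0..min a b.
             scal ((- 1) ^ s * q powi (- int s - int s * (int a - int b + m)) / qpoch s)
               * Fdiv (b - s) * Ediv (a - s) * idem m)"
    unfolding w_elt_eq[OF vacuum_lim_w_sum_FE] w_sum_def w_coeff_def sum_distrib_right
    by (simp only: Ediv_eq_dpow Fdiv_eq_dpow mult.assoc min.commute)
qed

end
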